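(* As functions of $x$ and $q$ (with $|q|<1$), $$x\frac{(q)_\infty^2}{(-q)_\infty}[C^*(x;q)]^3J(-x;q)=2(1+x)\delta_qN^*+\tfrac12xN^*+x\delta_xN^*+\tfrac12(1+x)\delta_x^2N^*,$$ where $N^*=N^*(1,0,x;q)$, and $$x\frac{(q)_\infty^2}{(-q)_\infty}[C(x;q)]^3J(-x;q)=2(1-x)^2(1+x)\delta_qN+x(1+x)N+2x(1-x)\delta_xN+\tfrac12(1+x)(1-x)^2\delta_x^2N,$$ where $N=N(1,0,x;q)$.
   Context: $(a_1,\dots,a_j;q)_\infty=\prod_{t\ge0}\prod_i(1-a_iq^t)$, $(a_1,\dots,a_j;q)_n=(a_1,\dots,a_j;q)_\infty/(a_1q^n,\dots,a_jq^n;q)_\infty$, base dropped when it is $q$. $N(1,0,x;q):=\sum_{n\ge0}\frac{(-1)_nq^{n(n+1)/2}}{(xq,q/x)_n}$, $N^*(1,0,x;q):=N(1,0,x;q)/(1-x)$. $C(x;q):=\frac{(q)_\infty}{(xq,q/x)_\infty}$, $C^*(x;q):=C(x;q)/(1-x)$, $J(x;q):=(x,q/x)_\infty$ (so $J(-x;q)=(-x,-q/x)_\infty$). $\delta_q:=q\frac{\partial}{\partial q}$, $\delta_x:=x\frac{\partial}{\partial x}$; products such as $(1+x)\delta_x^2N$ mean multiplication by $(1+x)$ after applying $\delta_x^2$. *)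

theory Defs
  imports "HOL-Analysis.Analysis"
begin

definition qpoch_inf :: "complex list \<Rightarrow> complex \<Rightarrow> complex" where
  "qpoch_inf as q = (\<Prod>t. \<Prod>a\<leftarrow>as. 1 - a * q ^ t)"

definition qpoch :: "complex list \<Rightarrow> complex \<Rightarrow> nat \<Rightarrow> complex" where
  "qpoch as q n = qpoch_inf as q / qpoch_inf (map (\<lambda>a. a * q ^ n) as) q"

text \<open>
  The functions below take the arguments x and q, in this order. The functions \<open>N10\<close> and
  \<open>N10_star\<close> are N(1,0,x;q) and N*(1,0,x;q), and \<open>C_star\<close> is C*(x;q).
\<close>

definition N10 :: "complex \<Rightarrow> complex \<Rightarrow> complex" where
  "N10 x q = (\<Sum>n. qpoch [-1] q n * q ^ (n * (n + 1) div 2) / qpoch [x * q, q / x] q n)"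

definition N10_star :: "complex \<Rightarrow> complex \<Rightarrow> complex" where
  "N10_star x q = N10 x q / (1 - x)"

definition C_fun :: "complex \<Rightarrow> complex \<Rightarrow> complex" where
  "C_fun x q = qpoch_inf [q] q / qpoch_inf [x * q, q / x] q"

definition C_star :: "complex \<Rightarrow> complex \<Rightarrow> complex" where
  "C_star x q = C_fun x q / (1 - x)"

definition J_fun :: "complex \<Rightarrow> complex \<Rightarrow> complex" where
  "J_fun x q = qpoch_inf [x, q / x] q"

definition delta_q :: "(complex \<Rightarrow> complex \<Rightarrow> complex) \<Rightarrow> complex \<Rightarrow> complex \<Rightarrow> complex" where
  "delta_q F x q = q * deriv (\<lambda>q'. F x q') q"

definition delta_x :: "(complex \<Rightarrow> complex \<Rightarrow> complex) \<Rightarrow> complex \<Rightarrow> complex \<Rightarrow> complex" where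
  "delta_x F x q = x * deriv (\<lambda>x'. F x' q) x"

end

theory Submission
  imports Defs "HOL-Complex_Analysis.Complex_Analysis"
begin

text \<open>
  Put \<open>M = (1 + x) N*\<close>. The right-hand side of the first identity is the heat operator
  \<open>2 \<delta>\<^sub>q + \<delta>\<^sub>x\<^sup>2 / 2\<close> applied to \<open>M\<close>. A telescoping sum gives
  \<open>M(xq) = -q x\<^sup>2 (M(x) + 1) + 1\<close>, and the heat operator turns this into the homogeneous
  equation \<open>K(xq) = -q x\<^sup>2 K(x)\<close> for \<open>K\<close>, the image of \<open>M\<close>; the theta quotient on the left-hand
  side satisfies the same equation. The quotient of the two sides is therefore invariant under
  \<open>x \<mapsto> xq\<close>. On the annulus \<open>|q| < |x| < 1/|q|\<close> the left-hand side vanishes only at \<open>x = -1\<close>,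
  to first order, and \<open>K\<close> vanishes there because \<open>N(x) = N(1/x)\<close>. So the quotient is holomorphic on
  this annulus, and the maximum modulus principle makes it constant. Its value 1
  is read off at \<open>x = 1\<close> from a limiting case of the q-Gauss sum.
\<close>

subsection \<open>Separately holomorphic functions of two variables\<close>

text \<open>The weights in \<open>heat\<close> are forced. Let T be the shift of x to xq and m = -q
  x^2. Then \<open>delta_x\<close> commutes with T, \<open>delta_q\<close> after T equals T after
  (\<open>delta_q\<close> + \<open>delta_x\<close>), and m is multiplied by 2 under
  \<open>delta_x\<close> and by 1 under \<open>delta_q\<close>. For a \<open>delta_q\<close> + b
  \<open>delta_x\<close>^2 the stray multiples of M + 1 and of \<open>delta_x\<close> M both cancel
  exactly when a = 4b. The price is a derivative in q of an equation whose shifted argument xq moves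
  with q: it is taken along the curve t -> (xt, t), so N must be handled jointly in x and q.
  Separate holomorphy with joint continuity suffices for this, and joint continuity comes from
  locally uniform convergence of the series. At x = 1 the function \<open>heat\<close> M has a pole
  of order three. Multiplying by (1 - x)^3 clears it and yields the second identity, which is
  therefore the one proved; the first is its quotient by that cube. The annulus avoids every pole
  q^n (n nonzero) of N, yet contains a compact fundamental annulus of the shift. The shift carries
  the identity to the remaining x, and q = 0 is checked by hand.\<close>

definition sep_holomorphic_on :: "(complex \<Rightarrow> complex \<Rightarrow> complex) \<Rightarrow> (complex \<times> complex) set \<Rightarrow> bool"
  (infixl \<open>sep'_holomorphic'_on\<close> 50) where
  "f sep_holomorphic_on U \<longleftrightarrow>
     continuous_on U (\<lambda>p. f (fst p) (snd p)) \<and>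
     (\<forall>x q. (x, q) \<in> U \<longrightarrow> (\<lambda>x. f x q) field_differentiable at x \<and> f x field_differentiable at q)"

lemma open_contains_cball_Times:
  fixes x q :: complex
  assumes "open U" "(x, q) \<in> U"
  obtains e where "e > 0" "cball x e \<times> cball q e \<subseteq> U"
proof -
  obtain A B where AB: "open A" "open B" "x \<in> A" "q \<in> B" "A \<times> B \<subseteq> U"
    using assms by (metis SigmaE2 open_prod_elim)
  obtain d1 where d1: "d1 > 0" "cball x d1 \<subseteq> A" using AB open_contains_cball by metis
  obtain d2 where d2: "d2 > 0" "cball q d2 \<subseteq> B" using AB open_contains_cball by metis
  show ?thesis
  proof (rule that[of "min d1 d2"])
    show "min d1 d2 > 0" using d1 d2 by simp
    show "cball x (min d1 d2) \<times> cball q (min d1 d2) \<subseteq> U" using d1 d2 AB by fastforce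
  qed
qed

lemma sep_holomorphic_on_subset:
  "f sep_holomorphic_on U \<Longrightarrow> V \<subseteq> U \<Longrightarrow> f sep_holomorphic_on V"
  unfolding sep_holomorphic_on_def by (meson continuous_on_subset subsetD)

text \<open>Weierstrass' theorem on derivatives of uniform limits, with the point p itself as the
  parameter of the limit. Joint continuity of f on a compact bidisc supplies the uniform
  convergence.\<close>

lemma sep_holomorphic_tendsto_deriv:
  assumes f: "f sep_holomorphic_on U" and U: "open U" "(x0, q0) \<in> U"
  shows "((\<lambda>p. deriv (f (fst p)) (snd p)) \<longlongrightarrow> deriv (f x0) q0) (at (x0, q0))"
proof -
  obtain e where e: "e > 0" "cball x0 e \<times> cball q0 e \<subseteq> U"
    using open_contains_cball_Times[OF U] by blast
  have D: "\<And>x q. (x, q) \<in> U \<Longrightarrow> (f x has_field_derivative deriv (f x) q) (at q)"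
    using f by (simp add: sep_holomorphic_on_def DERIV_deriv_iff_field_differentiable)
  have "compact (cball x0 e \<times> cball q0 e)" by (intro compact_Times) auto
  then have uc: "uniformly_continuous_on (cball x0 e \<times> cball q0 e) (\<lambda>p. f (fst p) (snd p))"
    using f e by (auto intro!: compact_uniformly_continuous intro: continuous_on_subset simp: sep_holomorphic_on_def)
  \<comment> \<open>The translation puts \<open>snd p\<close> at the fixed centre q0, so that one
    disc serves for all p. Halving the radius leaves room for the displacement of p on top of that
    of w.\<close>
  define F where "F = (\<lambda>p w. f (fst p) (w + snd p - q0))"
  define r where "r = e / 2"
  have r: "r > 0" using e by (simp add: r_def)
  have near: "\<forall>\<^sub>F p in at (x0, q0). dist p (x0, q0) < d" if "d > 0" for d
    using that by (auto simp: eventually_at)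
  have inU: "(fst p, w + snd p - q0) \<in> cball x0 e \<times> cball q0 e"
    if "dist p (x0, q0) < r" "w \<in> cball q0 r" for p w
  proof -
    have "dist (fst p) x0 < r" "dist (snd p) q0 < r"
      using that dist_fst_le[of p "(x0,q0)"] dist_snd_le[of p "(x0,q0)"] by auto
    moreover have "dist q0 (w + snd p - q0) \<le> dist q0 w + dist (snd p) q0"
      unfolding dist_norm using norm_triangle_ineq4[of "q0 - w" "snd p - q0"] by (simp add: algebra_simps)
    moreover have "dist q0 w \<le> r" "r \<le> e" using that e by (auto simp: r_def)
    ultimately have "dist x0 (fst p) \<le> e" "dist q0 (w + snd p - q0) \<le> e"
      using e unfolding r_def by (simp_all only: dist_commute)
    then show ?thesis by auto
  qed
  have 1: "\<forall>\<^sub>F p in at (x0, q0). continuous_on (cball q0 r) (F p) \<and>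
      (\<forall>w\<in>ball q0 r. (F p has_field_derivative deriv (f (fst p)) (w + snd p - q0)) (at w))"
    using near[OF r]
  proof eventually_elim
    case (elim p)
    have DF: "(F p has_field_derivative deriv (f (fst p)) (w + snd p - q0)) (at w)" if "w \<in> cball q0 r" for w
    proof -
      have "(fst p, w + snd p - q0) \<in> U" using inU[OF elim that] e by blast
      from D[OF this] have "(f (fst p) has_field_derivative deriv (f (fst p)) (w + snd p - q0)) (at (w + (snd p - q0)))"
        by (simp add: algebra_simps)
      then have "((\<lambda>w. f (fst p) (w + (snd p - q0))) has_field_derivative deriv (f (fst p)) (w + snd p - q0)) (at w)"
        by (subst (asm) DERIV_shift)
      then show ?thesis by (simp add: F_def add_diff_eq)
    qed
    then have "continuous_on (cball q0 r) (F p)"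
      by (meson DERIV_isCont continuous_at_imp_continuous_on)
    with DF show ?case by auto
  qed
  have 2: "uniform_limit (cball q0 r) F (f x0) (at (x0, q0))"
  proof (rule uniform_limitI)
    fix \<epsilon> :: real assume "\<epsilon> > 0"
    then obtain d where d: "d > 0" "\<And>p p'. p \<in> cball x0 e \<times> cball q0 e \<Longrightarrow> p' \<in> cball x0 e \<times> cball q0 e
        \<Longrightarrow> dist p' p < d \<Longrightarrow> dist (f (fst p') (snd p')) (f (fst p) (snd p)) < \<epsilon>"
      using uc unfolding uniformly_continuous_on_def by meson
    have "\<forall>\<^sub>F p in at (x0, q0). dist p (x0, q0) < min d r" using d r by (intro near) simp
    then show "\<forall>\<^sub>F p in at (x0, q0). \<forall>w\<in>cball q0 r. dist (F p w) (f x0 w) < \<epsilon>"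
    proof eventually_elim
      case (elim p)
      show ?case
      proof
        fix w assume w: "w \<in> cball q0 r"
        have "dist (fst p, w + snd p - q0) (x0, w) = dist p (x0, q0)"
          by (cases p) (simp add: dist_Pair_Pair dist_norm algebra_simps)
        moreover have "(x0, w) \<in> cball x0 e \<times> cball q0 e" using w e by (auto simp: r_def)
        ultimately show "dist (F p w) (f x0 w) < \<epsilon>"
          using d(2)[of "(x0, w)" "(fst p, w + snd p - q0)"] inU[OF _ w, of p] elim by (simp add: F_def)
      qed
    qed
  qed
  obtain g' where g': "\<And>w. w \<in> ball q0 r \<Longrightarrow> (f x0 has_field_derivative g' w) (at w) \<and>
      ((\<lambda>p. deriv (f (fst p)) (w + snd p - q0)) \<longlongrightarrow> g' w) (at (x0, q0))"
    by (rule has_complex_derivative_uniform_limit[OF 1 2 _ r]) (auto simp: at_neq_bot)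
  have "g' q0 = deriv (f x0) q0" using g'[of q0] r DERIV_imp_deriv[of "f x0" "g' q0" q0] by simp
  then show ?thesis using g'[of q0] r by simp
qed

lemma sep_holomorphic_continuous_deriv:
  assumes f: "f sep_holomorphic_on U" and U: "open U"
  shows "continuous_on U (\<lambda>p. deriv (f (fst p)) (snd p))"
  unfolding continuous_on_eq_continuous_at[OF U]
  using sep_holomorphic_tendsto_deriv[OF f U] by (auto simp: isCont_def)

text \<open>Total differentiability requires joint continuity of only one of the two partial
  derivatives; the preceding lemma provides it for the derivative in q.\<close>

lemma sep_holomorphic_chain:
  assumes f: "f sep_holomorphic_on U" and U: "open U" "(a t, b t) \<in> U"
    and a: "(a has_field_derivative a') (at t)" and b: "(b has_field_derivative b') (at t)"
  shows "((\<lambda>t. f (a t) (b t)) has_field_derivative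
           deriv (\<lambda>x. f x (b t)) (a t) * a' + deriv (f (a t)) (b t) * b') (at t)"
proof -
  obtain e where e: "e > 0" "cball (a t) e \<times> cball (b t) e \<subseteq> U"
    using open_contains_cball_Times[OF U] by blast
  let ?X = "ball (a t) e" and ?Y = "ball (b t) e"
  have sub: "?X \<times> ?Y \<subseteq> U" using e ball_subset_cball by blast
  define fy where "fy = (\<lambda>x y. blinfun_mult_right (deriv (f x) y))"
  have "((\<lambda>(x, y). f x y) has_derivative
      (\<lambda>(tx, ty). deriv (\<lambda>x. f x (b t)) (a t) * tx + blinfun_apply (fy (a t) (b t)) ty))
      (at (a t, b t) within ?X \<times> ?Y)"
  proof (rule has_derivative_partialsI)
    have "(\<lambda>x. f x (b t)) field_differentiable at (a t)"
      using f U by (auto simp: sep_holomorphic_on_def)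
    then show "((\<lambda>x. f x (b t)) has_derivative (*) (deriv (\<lambda>x. f x (b t)) (a t))) (at (a t) within ?X)"
      by (simp add: DERIV_deriv_iff_field_differentiable[symmetric] has_field_derivative_def has_derivative_at_withinI)
    show "(f x has_derivative blinfun_apply (fy x y)) (at y within ?Y)" if "x \<in> ?X" "y \<in> ?Y" for x y
    proof -
      have "(x, y) \<in> U" using that sub by blast
      then have "(f x has_field_derivative deriv (f x) y) (at y)"
        using f by (simp add: sep_holomorphic_on_def DERIV_deriv_iff_field_differentiable)
      then show ?thesis
        by (simp add: fy_def has_field_derivative_def has_derivative_at_withinI)
    qed
    have "continuous (at (a t, b t)) (\<lambda>p. deriv (f (fst p)) (snd p))"
      using sep_holomorphic_continuous_deriv[OF f U(1)] U by (simp add: continuous_on_eq_continuous_at)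
    then have "continuous (at (a t, b t)) (\<lambda>p. blinfun_mult_right (deriv (f (fst p)) (snd p)))"
      by (intro continuous_intros bounded_linear.continuous[OF bounded_linear_blinfun_mult_right])
    then show "continuous (at (a t, b t) within ?X \<times> ?Y) (\<lambda>(x, y). fy x y)"
      by (simp add: fy_def case_prod_beta' continuous_at_imp_continuous_at_within)
  qed (use e in auto)
  then have "((\<lambda>(x, y). f x y) has_derivative
      (\<lambda>(tx, ty). deriv (\<lambda>x. f x (b t)) (a t) * tx + deriv (f (a t)) (b t) * ty)) (at (a t, b t))"
    using e by (subst (asm) at_within_open) (auto simp: open_Times fy_def)
  moreover have "((\<lambda>t. (a t, b t)) has_derivative (\<lambda>h. (a' * h, b' * h))) (at t)"
    using a b by (auto intro!: has_derivative_Pair simp: has_field_derivative_def)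
  ultimately have "((\<lambda>(x, y). f x y) \<circ> (\<lambda>t. (a t, b t)) has_derivative
      (\<lambda>(tx, ty). deriv (\<lambda>x. f x (b t)) (a t) * tx + deriv (f (a t)) (b t) * ty) \<circ> (\<lambda>h. (a' * h, b' * h))) (at t)"
    by (rule diff_chain_at[rotated])
  then have "((\<lambda>t. f (a t) (b t)) has_derivative
      (\<lambda>(tx, ty). deriv (\<lambda>x. f x (b t)) (a t) * tx + deriv (f (a t)) (b t) * ty) \<circ> (\<lambda>h. (a' * h, b' * h))) (at t)"
    by (simp add: o_def)
  then show ?thesis
    unfolding has_field_derivative_def
    by (rule has_derivative_eq_rhs) (simp add: fun_eq_iff o_def algebra_simps)
qed

text \<open>The difference quotients in q are holomorphic in x and converge uniformly in x as h
  tends to 0, so their limit is holomorphic. This is what makes \<open>delta_q\<close> N holomorphic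
  in x.\<close>

lemma sep_holomorphic_deriv_field_differentiable:
  assumes f: "f sep_holomorphic_on U" and U: "open U" "(x0, q0) \<in> U"
  shows "(\<lambda>x. deriv (f x) q0) field_differentiable at x0"
proof -
  obtain e where e: "e > 0" "cball x0 e \<times> cball q0 e \<subseteq> U"
    using open_contains_cball_Times[OF U] by blast
  have D: "\<And>x q. (x, q) \<in> U \<Longrightarrow> (f x has_field_derivative deriv (f x) q) (at q)"
    using f by (simp add: sep_holomorphic_on_def DERIV_deriv_iff_field_differentiable)
  have "compact (cball x0 e \<times> cball q0 e)" by (intro compact_Times) auto
  then have uc: "uniformly_continuous_on (cball x0 e \<times> cball q0 e) (\<lambda>p. deriv (f (fst p)) (snd p))"
    using continuous_on_subset[OF sep_holomorphic_continuous_deriv[OF f U(1)] e(2)]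
    by (rule compact_uniformly_continuous[rotated])
  define G where "G = (\<lambda>h x. (f x (q0 + h) - f x q0) / h)"
  have near: "\<forall>\<^sub>F h in at 0. h \<noteq> 0 \<and> norm h < d" if "d > 0" for d :: real and h :: complex
    using that by (auto simp: eventually_at)
  have 1: "\<forall>\<^sub>F h in at 0. continuous_on (cball x0 e) (G h) \<and> G h holomorphic_on ball x0 e"
    using near[OF e(1)]
  proof eventually_elim
    case (elim h)
    have "G h field_differentiable at x" if "x \<in> cball x0 e" for x
    proof -
      have "(x, q0) \<in> U" "(x, q0 + h) \<in> U" using that e elim by (auto simp: dist_norm)
      then show ?thesis using f elim unfolding G_def sep_holomorphic_on_def
        by (intro field_differentiable_divide field_differentiable_diff) auto
    qed
    then have "G h holomorphic_on cball x0 e"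
      unfolding holomorphic_on_def by (blast intro: field_differentiable_at_within)
    then show ?case
      by (meson ball_subset_cball holomorphic_on_imp_continuous_on holomorphic_on_subset)
  qed
  have 2: "uniform_limit (cball x0 e) G (\<lambda>x. deriv (f x) q0) (at 0)"
  proof (rule uniform_limitI)
    fix \<epsilon> :: real assume \<epsilon>: "\<epsilon> > 0"
    then obtain d where d: "d > 0" "\<And>p p'. p \<in> cball x0 e \<times> cball q0 e \<Longrightarrow> p' \<in> cball x0 e \<times> cball q0 e
        \<Longrightarrow> dist p' p < d \<Longrightarrow> dist (deriv (f (fst p')) (snd p')) (deriv (f (fst p)) (snd p)) < \<epsilon> / 2"
      using uc unfolding uniformly_continuous_on_def by (meson half_gt_zero)
    show "\<forall>\<^sub>F h in at 0. \<forall>x\<in>cball x0 e. dist (G h x) (deriv (f x) q0) < \<epsilon>"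
    proof -
      have "\<forall>\<^sub>F h in at 0. h \<noteq> 0 \<and> norm h < min d e" using d e by (intro near) simp
      then show ?thesis
      proof eventually_elim
        case (elim h)
        show ?case
        proof
          fix x assume x: "x \<in> cball x0 e"
          let ?D = "deriv (f x) q0"
          \<comment> \<open>After subtraction of the linear function with slope \<open>?D\<close>,
            the derivative is at most \<epsilon>/2 on the disc by uniform continuity, and the mean
            value inequality bounds the error of the difference quotient independently of x.\<close>
          have "norm ((f x (q0 + h) - ?D * (q0 + h)) - (f x q0 - ?D * q0)) \<le> \<epsilon> / 2 * norm ((q0 + h) - q0)"
          proof (rule field_differentiable_bound[of "cball q0 (norm h)"])
            fix w assume w: "w \<in> cball q0 (norm h)"
            have xw: "(x, w) \<in> cball x0 e \<times> cball q0 e" using w x elim by auto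
            then show "((\<lambda>w. f x w - ?D * w) has_field_derivative deriv (f x) w - ?D) (at w within cball q0 (norm h))"
              using e has_field_derivative_at_within[OF D[of x w]]
              by (intro derivative_eq_intros | force)+
            have "dist (x, w) (x, q0) < d" using w elim by (simp add: dist_Pair_Pair dist_commute)
            with d(2)[of "(x, q0)" "(x, w)"] xw x e show "norm (deriv (f x) w - ?D) \<le> \<epsilon> / 2"
              by (auto simp: dist_norm)
          qed (auto simp: dist_norm)
          then have "norm (f x (q0 + h) - f x q0 - ?D * h) \<le> \<epsilon> / 2 * norm h"
            by (simp add: algebra_simps)
          moreover have "G h x - ?D = (f x (q0 + h) - f x q0 - ?D * h) / h"
            using elim by (simp add: G_def field_simps)
          ultimately have "norm (G h x - ?D) \<le> \<epsilon> / 2"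
            using elim by (simp only: norm_divide) (simp add: pos_divide_le_eq)
          then show "dist (G h x) ?D < \<epsilon>" using \<epsilon> by (simp add: dist_norm)
        qed
      qed
    qed
  qed
  have "(\<lambda>x. deriv (f x) q0) holomorphic_on ball x0 e"
    by (rule holomorphic_uniform_limit[OF 1 2]) auto
  then show ?thesis
    using e by (simp add: holomorphic_on_open field_differentiable_def)
qed

subsection \<open>Infinite q-products and the rank series\<close>

lemma convergent_prod_qpoch:
  fixes a q :: complex
  assumes "norm q < 1"
  shows "convergent_prod (\<lambda>t. 1 - a * q ^ t)"
  using assms by (intro abs_convergent_prod_imp_convergent_prod)
    (auto simp: abs_convergent_prod_conv_summable norm_mult norm_power intro!: summable_mult summable_geometric)

lemma qpoch_inf_pair:
  assumes "norm q < 1"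
  shows "qpoch_inf [a, b] q = qpoch_inf [a] q * qpoch_inf [b] q"
  using prodinf_mult[OF convergent_prod_qpoch[OF assms, of a] convergent_prod_qpoch[OF assms, of b]]
  by (simp add: qpoch_inf_def)

lemma qpoch_inf_split:
  assumes "norm q < 1"
  shows "qpoch_inf [a] q = (\<Prod>k<n. 1 - a * q ^ k) * qpoch_inf [a * q ^ n] q"
proof -
  have "prodinf (\<lambda>t. 1 - a * q ^ t) = (\<Prod>k<n. 1 - a * q ^ k) * (\<Prod>k. 1 - a * q ^ (k + n))"
    using has_prod_ignore_initial_segment'[OF convergent_prod_qpoch[OF assms]] has_prod_iff by blast
  then show ?thesis
    by (simp add: qpoch_inf_def power_add mult_ac)
qed

lemma qpoch_inf_Suc:
  "norm q < 1 \<Longrightarrow> qpoch_inf [a] q = (1 - a) * qpoch_inf [a * q] q"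
  using qpoch_inf_split[of q a 1] by simp

lemma qpoch_inf_nonzero:
  assumes "norm q < 1" "\<And>t. a * q ^ t \<noteq> 1"
  shows "qpoch_inf [a] q \<noteq> 0"
  unfolding qpoch_inf_def using prodinf_nonzero[OF convergent_prod_qpoch[OF assms(1)], of a] assms(2)
  by simp

lemma qpoch_eq_prod:
  assumes "norm q < 1" "\<And>t. a * q ^ (n + t) \<noteq> 1"
  shows "qpoch [a] q n = (\<Prod>k<n. 1 - a * q ^ k)"
proof -
  have "qpoch_inf [a * q ^ n] q \<noteq> 0"
    using assms by (intro qpoch_inf_nonzero) (auto simp: power_add mult.assoc)
  then show ?thesis
    using qpoch_inf_split[OF assms(1), of a n] by (simp add: qpoch_def)
qed

lemma qpoch_inf_holomorphic:
  assumes "norm q < 1"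
  shows "(\<lambda>a. qpoch_inf [a] q) holomorphic_on A"
proof -
  have "(\<lambda>a. qpoch_inf [a] q) holomorphic_on UNIV"
  proof (rule holomorphic_uniform_sequence)
    fix x :: complex
    have "uniformly_convergent_on (cball x 1) (\<lambda>N a. \<Prod>k<N. 1 - a * q ^ k)"
    proof (rule uniformly_convergent_on_prod')
      have "uniformly_convergent_on (cball x 1) (\<lambda>N a. \<Sum>k<N. norm (1 - a * q ^ k - 1))"
      proof (rule Weierstrass_m_test'[where M = "\<lambda>k. (norm x + 1) * norm q ^ k"])
        fix k a assume "a \<in> cball x 1"
        then have "norm a \<le> norm x + 1"
          using norm_triangle_ineq2[of a x] by (simp add: dist_norm norm_minus_commute)
        then show "norm (norm (1 - a * q ^ k - 1)) \<le> (norm x + 1) * norm q ^ k"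
          by (simp add: norm_mult norm_power mult_right_mono)
      qed (use assms in \<open>auto intro!: summable_mult summable_geometric\<close>)
      then show "uniformly_convergent_on (cball x 1) (\<lambda>N a. \<Sum>k<N. norm (1 - a * q ^ k - 1))" .
    qed (auto intro!: continuous_intros)
    then have "uniform_limit (cball x 1) (\<lambda>N a. \<Prod>k<N. 1 - a * q ^ k) (\<lambda>a. lim (\<lambda>N. \<Prod>k<N. 1 - a * q ^ k)) sequentially"
      by (simp add: uniformly_convergent_uniform_limit_iff)
    moreover have "lim (\<lambda>N. \<Prod>k<N. 1 - a * q ^ k) = qpoch_inf [a] q" for a
    proof -
      have "(\<lambda>N. \<Prod>k\<le>N. 1 - a * q ^ k) \<longlonglongrightarrow> qpoch_inf [a] q"
        using convergent_prod_LIMSEQ[OF convergent_prod_qpoch[OF assms]] by (simp add: qpoch_inf_def)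
      then have "(\<lambda>N. \<Prod>k<Suc N. 1 - a * q ^ k) \<longlonglongrightarrow> qpoch_inf [a] q"
        by (simp add: lessThan_Suc_atMost)
      then show ?thesis by (rule LIMSEQ_imp_Suc[THEN limI])
    qed
    ultimately show "\<exists>d>0. cball x d \<subseteq> UNIV \<and>
        uniform_limit (cball x d) (\<lambda>N a. \<Prod>k<N. 1 - a * q ^ k) (\<lambda>a. qpoch_inf [a] q) sequentially"
      by (intro exI[of _ 1]) auto
  qed (auto intro!: holomorphic_intros)
  then show ?thesis by (rule holomorphic_on_subset) auto
qed

section \<open>The series of N on its natural domain: locally uniform convergence and
  holomorphy\<close>

text \<open>The power q^(n(n+1)/2) is distributed over the factors as q^(k+1), so that consecutive
  terms differ by one explicit factor.\<close>

definition rank_term :: "complex \<Rightarrow> complex \<Rightarrow> nat \<Rightarrow> complex" where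
  "rank_term x q n = (\<Prod>k<n. (1 + q ^ k) * q ^ Suc k / ((1 - x * q ^ Suc k) * (1 - q ^ Suc k / x)))"

text \<open>The exponents start at 1: the point x = 1 is not a pole of N and has to stay, since the
  final constant is read off there.\<close>

definition rank_dom :: "(complex \<times> complex) set" where
  "rank_dom = {(x, q). norm q < 1 \<and> x \<noteq> 0 \<and> (\<forall>n\<ge>1. x * q ^ n \<noteq> 1 \<and> q ^ n / x \<noteq> 1)}"

lemma prod_power_Suc: "(\<Prod>k<n. q ^ Suc k) = (q :: 'a :: comm_monoid_mult) ^ (n * (n + 1) div 2)"
proof (induction n)
  case (Suc n)
  have "Suc n * (Suc n + 1) div 2 = n * (n + 1) div 2 + Suc n"
    by (simp add: algebra_simps)
  with Suc show ?case by (simp only: prod.lessThan_Suc power_add)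
qed simp

lemma power_neq_minus_one:
  fixes q :: complex
  assumes "norm q < 1"
  shows "q ^ n \<noteq> -1"
proof (cases n)
  case (Suc m)
  have "norm (q ^ n) < 1" using assms Suc by (simp add: norm_power power_less_one_iff del: power_Suc)
  then show ?thesis by auto
qed simp

lemma power_neq_one:
  fixes q :: complex
  assumes "norm q < 1" "n > 0"
  shows "q ^ n \<noteq> 1"
proof
  have "norm (q ^ n) < 1" using assms by (simp add: norm_power power_less_one_iff)
  moreover assume "q ^ n = 1"
  ultimately show False by simp
qed

lemma mult_power_neq_one:
  fixes q c :: complex
  assumes "norm q < 1" "norm c < 1"
  shows "c * q ^ k \<noteq> 1"
proof
  assume "c * q ^ k = 1"
  then have "norm c * norm q ^ k = 1" by (metis norm_mult norm_one norm_power)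
  moreover have "norm c * norm q ^ k \<le> norm c * 1"
    using assms by (intro mult_left_mono power_le_one) auto
  ultimately show False using assms by simp
qed

lemma rank_domD:
  assumes "(x, q) \<in> rank_dom"
  shows "norm q < 1" "x \<noteq> 0" "x * q ^ Suc k \<noteq> 1" "q ^ Suc k / x \<noteq> 1" "q ^ Suc k \<noteq> x"
  using assms unfolding rank_dom_def by (auto simp del: power_Suc)

lemma N10_eq_suminf:
  assumes "(x, q) \<in> rank_dom"
  shows "N10 x q = (\<Sum>n. rank_term x q n)"
  unfolding N10_def
proof (intro suminf_cong)
  fix n
  note D = rank_domD[OF assms]
  have "-1 * q ^ m \<noteq> 1" for m
    using power_neq_minus_one[OF D(1), of m] by (metis minus_minus mult_minus1)
  then have 1: "qpoch [-1] q n = (\<Prod>k<n. 1 + q ^ k)"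
    by (subst qpoch_eq_prod[OF D(1)]) auto
  have 2: "qpoch [x * q] q n = (\<Prod>k<n. 1 - x * q ^ Suc k)"
    using D(3) by (subst qpoch_eq_prod[OF D(1)]) (auto simp: mult.assoc)
  have 3: "qpoch [q / x] q n = (\<Prod>k<n. 1 - q ^ Suc k / x)"
    using D(4) by (subst qpoch_eq_prod[OF D(1)]) (auto simp: mult_ac)
  have 4: "qpoch [x * q, q / x] q n = qpoch [x * q] q n * qpoch [q / x] q n"
    unfolding qpoch_def by (simp add: qpoch_inf_pair[OF D(1)])
  show "qpoch [-1] q n * q ^ (n * (n + 1) div 2) / qpoch [x * q, q / x] q n = rank_term x q n"
    unfolding 4 1 2 3 prod_power_Suc[symmetric] rank_term_def by (simp add: prod.distrib prod_dividef)
qed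

lemma rank_term_Suc:
  "rank_term x q (Suc n) = rank_term x q n *
     ((1 + q ^ n) * q ^ Suc n / ((1 - x * q ^ Suc n) * (1 - q ^ Suc n / x)))"
  by (simp add: rank_term_def)

lemma continuous_on_rank_term:
  "continuous_on rank_dom (\<lambda>p. rank_term (fst p) (snd p) n)"
  unfolding rank_term_def
  by (intro continuous_intros) (auto dest: rank_domD simp del: power_Suc)

text \<open>Near a given point the ratio of consecutive terms is a bounded multiple of q^n. Beyond
  some index n0 smallness of q^n alone keeps the denominators away from 0 and halves the terms; the
  finitely many conditions up to n0 are open and define \<open>W\<close>.\<close>

lemma rank_term_dominated:
  assumes "(x0, q0) \<in> rank_dom"
  obtains e M where "e > 0" "cball x0 e \<times> cball q0 e \<subseteq> rank_dom" "summable M"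
    "\<forall>\<^sub>F n in sequentially. \<forall>p\<in>cball x0 e \<times> cball q0 e. norm (rank_term (fst p) (snd p) n) \<le> M n"
proof -
  note D0 = rank_domD[OF assms]
  \<comment> \<open>Here r bounds |q| and B bounds both |x| and 1/|x| on the bidisc, where |q| stays
    below the midpoint of |q0| and 1, and |x| between |x0|/2 and 2|x0|.\<close>
  define r where "r = (1 + norm q0) / 2"
  define B where "B = 2 * norm x0 + 2 / norm x0"
  have r: "0 \<le> r" "r < 1" using D0 by (auto simp: r_def add_nonneg_nonneg)
  have B: "B \<ge> 0" by (simp add: B_def)
  have "(\<lambda>n. (B + 16) * r ^ n) \<longlonglongrightarrow> (B + 16) * 0"
    using r by (intro tendsto_intros LIMSEQ_realpow_zero) auto
  \<comment> \<open>The summand 16 gives r^n < 1/32, which makes the later ratio at most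
    (2/32)/(1/4), hence below 1/2; the summand B gives 1/2 as a bound for |x q^n| and
    |q^n/x|.\<close>
  then have "\<forall>\<^sub>F n in sequentially. (B + 16) * r ^ n < 1 / 2"
    by (rule order_tendstoD) simp
  then obtain n0 where n0: "(B + 16) * r ^ n < 1 / 2" if "n \<ge> n0" for n
    by (auto simp: eventually_sequentially)
  define W where "W = (\<Inter>k\<in>{1..n0}. {p :: complex \<times> complex. fst p * snd p ^ k \<noteq> 1} \<inter> {p. snd p ^ k \<noteq> fst p})"
  have "open W" unfolding W_def
    by (intro open_INT finite_atLeastAtMost ballI open_Int open_Collect_neq continuous_intros)
  moreover have "(x0, q0) \<in> W"
  proof -
    have "x0 * q0 ^ k \<noteq> 1 \<and> q0 ^ k \<noteq> x0" if "k \<ge> 1" for k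
      using D0(3,5)[of "k - 1"] that by simp
    then show ?thesis unfolding W_def by simp
  qed
  ultimately obtain e2 where e2: "e2 > 0" "cball x0 e2 \<times> cball q0 e2 \<subseteq> W"
    using open_contains_cball_Times by blast
  define e where "e = min e2 (min ((1 - norm q0) / 2) (norm x0 / 2))"
  have e: "e > 0" using e2 D0 by (simp add: e_def)
  let ?P = "cball x0 e \<times> cball q0 e"
  have bd: "norm q \<le> r" "norm x \<le> B" "1 / norm x \<le> B" "x \<noteq> 0" if "(x, q) \<in> ?P" for x q
  proof -
    have "norm (q - q0) \<le> (1 - norm q0) / 2" "norm (x - x0) \<le> norm x0 / 2"
      using that by (auto simp: e_def dist_norm norm_minus_commute)
    then have *: "norm q \<le> r" "norm x \<le> 2 * norm x0" "norm x \<ge> norm x0 / 2"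
      using norm_triangle_ineq2[of q q0] norm_triangle_ineq2[of x x0] norm_triangle_ineq2[of x0 x] norm_ge_zero[of x0]
      by (auto simp: r_def norm_minus_commute simp del: norm_ge_zero)
    from * D0(2) show x: "x \<noteq> 0" by auto
    have "1 / norm x \<le> 1 / (norm x0 / 2)" using * D0(2) x by (intro divide_left_mono) auto
    with * show "norm q \<le> r" "norm x \<le> B" "1 / norm x \<le> B"
      unfolding B_def by (auto intro: order_trans add_increasing add_increasing2)
  qed
  have far: "norm (x * q ^ n) \<le> 1 / 2" "norm (q ^ n / x) \<le> 1 / 2" "norm (q ^ n) \<le> 1 / 32"
    if "(x, q) \<in> ?P" "n \<ge> n0" for x q n
  proof -
    note b = bd[OF that(1)]
    have qn: "norm (q ^ n) \<le> r ^ n" using b by (simp add: norm_power power_mono)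
    have "norm (x * q ^ n) \<le> B * r ^ n"
      using b qn B unfolding norm_mult by (intro mult_mono) auto
    moreover have "norm (q ^ n / x) = 1 / norm x * norm (q ^ n)" by (simp add: norm_divide)
    then have "norm (q ^ n / x) \<le> B * r ^ n"
      using b qn B by (simp only:) (intro mult_mono, auto)
    moreover have "B * r ^ n \<ge> 0" "r ^ n \<ge> 0" using B r by auto
    ultimately show "norm (x * q ^ n) \<le> 1 / 2" "norm (q ^ n / x) \<le> 1 / 2" "norm (q ^ n) \<le> 1 / 32"
      using n0[OF that(2)] qn by (auto simp: algebra_simps)
  qed
  have sub: "?P \<subseteq> rank_dom"
  proof safe
    fix x q assume "x \<in> cball x0 e" "q \<in> cball q0 e"
    then have p: "(x, q) \<in> ?P" by simp
    note b = bd[OF p]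
    have "x * q ^ n \<noteq> 1 \<and> q ^ n / x \<noteq> 1" if "n \<ge> 1" for n
    proof (cases "n \<le> n0")
      case True
      have "(x, q) \<in> W" using p e2 by (auto simp: e_def)
      then show ?thesis using True that b by (auto simp: W_def)
    next
      case False
      then show ?thesis using far[OF p, of n] by auto
    qed
    then show "(x, q) \<in> rank_dom" using b r by (auto simp: rank_dom_def)
  qed
  have "compact ?P" by (intro compact_Times) auto
  then have "bounded ((\<lambda>p. rank_term (fst p) (snd p) n0) ` ?P)"
    using continuous_on_subset[OF continuous_on_rank_term sub]
    by (intro compact_imp_bounded compact_continuous_image)
  then obtain C where C: "\<And>p. p \<in> ?P \<Longrightarrow> norm (rank_term (fst p) (snd p) n0) \<le> C"
    unfolding bounded_iff by blast
  have tail: "norm (rank_term x q (n0 + m)) \<le> C * (1 / 2) ^ m" if p: "(x, q) \<in> ?P" for x q m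
  proof (induction m)
    case 0
    then show ?case using C[OF p] by simp
  next
    case (Suc m)
    define n where "n = n0 + m"
    note b = bd[OF p]
    have g: "norm (1 - z) \<ge> 1 / 2" if "norm z \<le> 1 / 2" for z :: complex
      using norm_triangle_ineq2[of 1 z] that by simp
    have d: "norm (1 - x * q ^ Suc n) * norm (1 - q ^ Suc n / x) \<ge> 1 / 2 * (1 / 2)"
      using far[OF p, of "Suc n"] by (intro mult_mono g) (auto simp: n_def)
    have "norm (1 + q ^ n) \<le> 2"
      using norm_triangle_ineq[of 1 "q ^ n"] far(3)[OF p, of n] by (simp add: n_def)
    moreover have "norm (q ^ Suc n) \<le> 1 / 32" using far(3)[OF p, of "Suc n"] by (simp add: n_def)
    ultimately have nm: "norm (1 + q ^ n) * norm (q ^ Suc n) \<le> 2 * (1 / 32)"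
      by (intro mult_mono) auto
    have "norm (1 + q ^ n) * norm (q ^ Suc n) / (norm (1 - x * q ^ Suc n) * norm (1 - q ^ Suc n / x))
        \<le> (2 * (1 / 32)) / (1 / 2 * (1 / 2))"
      using d nm by (intro frac_le) auto
    also have "\<dots> \<le> 1 / 2" by simp
    finally have "norm (rank_term x q (Suc n)) \<le> norm (rank_term x q n) * (1 / 2)"
      unfolding rank_term_Suc norm_mult norm_divide by (rule mult_left_mono[OF _ norm_ge_zero])
    also have "\<dots> \<le> C * (1 / 2) ^ m * (1 / 2)"
      using Suc unfolding n_def by (intro mult_right_mono) auto
    finally show ?case by (simp add: n_def)
  qed
  show ?thesis
  proof (rule that[of e "\<lambda>n. C * 2 ^ n0 * (1 / 2) ^ n"])
    show "\<forall>\<^sub>F n in sequentially. \<forall>p\<in>?P. norm (rank_term (fst p) (snd p) n) \<le> C * 2 ^ n0 * (1 / 2) ^ n"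
      using eventually_ge_at_top[of n0]
    proof eventually_elim
      case (elim n)
      then obtain m where m: "n = n0 + m" using le_Suc_ex by blast
      show ?case using tail[of _ _ m] by (auto simp: m power_add power_one_over)
    qed
  qed (use e sub in \<open>auto intro!: summable_mult summable_geometric\<close>)
qed

lemma rank_uniform_limit:
  assumes "(x0, q0) \<in> rank_dom"
  obtains e where "e > 0" "cball x0 e \<times> cball q0 e \<subseteq> rank_dom"
    "uniform_limit (cball x0 e \<times> cball q0 e) (\<lambda>n p. \<Sum>i<n. rank_term (fst p) (snd p) i)
       (\<lambda>p. N10 (fst p) (snd p)) sequentially"
    "\<And>p. p \<in> cball x0 e \<times> cball q0 e \<Longrightarrow> summable (rank_term (fst p) (snd p))"
proof -
  obtain e M where eM: "e > 0" "cball x0 e \<times> cball q0 e \<subseteq> rank_dom" "summable M"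
    "\<forall>\<^sub>F n in sequentially. \<forall>p\<in>cball x0 e \<times> cball q0 e. norm (rank_term (fst p) (snd p) n) \<le> M n"
    using rank_term_dominated[OF assms] by blast
  show ?thesis
  proof (rule that[OF eM(1,2)])
    have "uniform_limit (cball x0 e \<times> cball q0 e) (\<lambda>n p. \<Sum>i<n. rank_term (fst p) (snd p) i)
        (\<lambda>p. \<Sum>i. rank_term (fst p) (snd p) i) sequentially"
      by (rule Weierstrass_m_test_ev[OF eM(4,3)])
    also have "?this \<longleftrightarrow> uniform_limit (cball x0 e \<times> cball q0 e) (\<lambda>n p. \<Sum>i<n. rank_term (fst p) (snd p) i)
       (\<lambda>p. N10 (fst p) (snd p)) sequentially"
      using eM(2) by (intro uniform_limit_cong') (auto simp: N10_eq_suminf)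
    finally show "uniform_limit (cball x0 e \<times> cball q0 e) (\<lambda>n p. \<Sum>i<n. rank_term (fst p) (snd p) i)
       (\<lambda>p. N10 (fst p) (snd p)) sequentially" .
    fix p assume p: "p \<in> cball x0 e \<times> cball q0 e"
    have "\<forall>\<^sub>F n in sequentially. norm (rank_term (fst p) (snd p) n) \<le> M n"
      using eM(4) by eventually_elim (use p in blast)
    then show "summable (rank_term (fst p) (snd p))"
      by (rule summable_comparison_test_ev[OF _ eM(3)])
  qed
qed

lemma summable_rank_term:
  assumes "(x, q) \<in> rank_dom"
  shows "summable (rank_term x q)"
proof (rule rank_uniform_limit[OF assms])
  fix e :: real
  assume "e > 0" and "\<And>p. p \<in> cball x e \<times> cball q e \<Longrightarrow> summable (rank_term (fst p) (snd p))"
  from this(2)[of "(x, q)"] this(1) show ?thesis by simp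
qed

text \<open>Infinitely many closed conditions are removed, so openness is not formal; the bidiscs
  from the convergence estimate witness it.\<close>

lemma open_rank_dom: "open rank_dom"
proof (subst open_subopen, rule ballI)
  fix p assume "p \<in> rank_dom"
  then obtain e where "e > 0" "cball (fst p) e \<times> cball (snd p) e \<subseteq> rank_dom"
    using rank_uniform_limit[of "fst p" "snd p"] by (metis prod.collapse)
  then show "\<exists>T. open T \<and> p \<in> T \<and> T \<subseteq> rank_dom"
    by (intro exI[of _ "ball (fst p) e \<times> ball (snd p) e"] conjI open_Times)
       (auto simp: mem_Times_iff subset_iff)
qed

lemma N10_sep_holomorphic: "N10 sep_holomorphic_on rank_dom"
  unfolding sep_holomorphic_on_def continuous_on_eq_continuous_at[OF open_rank_dom]
proof (intro conjI ballI allI impI)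
  fix p0 assume p0: "p0 \<in> rank_dom"
  obtain x0 q0 where pq: "p0 = (x0, q0)" by (cases p0)
  obtain e where e: "e > 0" "cball x0 e \<times> cball q0 e \<subseteq> rank_dom"
    "uniform_limit (cball x0 e \<times> cball q0 e) (\<lambda>n p. \<Sum>i<n. rank_term (fst p) (snd p) i)
       (\<lambda>p. N10 (fst p) (snd p)) sequentially"
    by (rule rank_uniform_limit[OF p0[unfolded pq]]) (erule (2) that)
  have "continuous_on (cball x0 e \<times> cball q0 e) (\<lambda>p. N10 (fst p) (snd p))"
    by (rule uniform_limit_theorem[OF _ e(3)])
       (auto intro!: always_eventually continuous_on_sum continuous_on_subset[OF continuous_on_rank_term e(2)])
  then have "continuous_on (ball x0 e \<times> ball q0 e) (\<lambda>p. N10 (fst p) (snd p))"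
    by (rule continuous_on_subset) auto
  then show "isCont (\<lambda>p. N10 (fst p) (snd p)) p0"
    by (subst (asm) continuous_on_eq_continuous_at) (use e pq in \<open>auto simp: open_Times\<close>)
next
  fix x0 q0 assume p0: "(x0, q0) \<in> rank_dom"
  obtain e where e: "e > 0" "cball x0 e \<times> cball q0 e \<subseteq> rank_dom"
    "uniform_limit (cball x0 e \<times> cball q0 e) (\<lambda>n p. \<Sum>i<n. rank_term (fst p) (snd p) i)
       (\<lambda>p. N10 (fst p) (snd p)) sequentially"
    by (rule rank_uniform_limit[OF p0]) (erule (2) that)
  have "(\<lambda>x. N10 x q0) holomorphic_on ball x0 e"
  proof (rule holomorphic_uniform_limit)
    show "uniform_limit (cball x0 e) (\<lambda>n x. \<Sum>i<n. rank_term x q0 i) (\<lambda>x. N10 x q0) sequentially"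
      using e(3) \<open>e > 0\<close> by (auto simp: uniform_limit_iff elim!: eventually_mono)
    have "(\<lambda>x. \<Sum>i<n. rank_term x q0 i) holomorphic_on cball x0 e" for n
    proof -
      have "(x, q0) \<in> rank_dom" if "x \<in> cball x0 e" for x using that e by auto
      then show ?thesis unfolding rank_term_def
        by (intro holomorphic_intros) (auto dest: rank_domD simp del: power_Suc)
    qed
    then show "\<forall>\<^sub>F n in sequentially. continuous_on (cball x0 e) (\<lambda>x. \<Sum>i<n. rank_term x q0 i) \<and>
        (\<lambda>x. \<Sum>i<n. rank_term x q0 i) holomorphic_on ball x0 e"
      using ball_subset_cball by (intro always_eventually allI conjI)
        (blast intro: holomorphic_on_imp_continuous_on holomorphic_on_subset)+
  qed auto
  then show "(\<lambda>x. N10 x q0) field_differentiable at x0"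
    using e by (simp add: holomorphic_on_open field_differentiable_def)
  have "N10 x0 holomorphic_on ball q0 e"
  proof (rule holomorphic_uniform_limit)
    show "uniform_limit (cball q0 e) (\<lambda>n q. \<Sum>i<n. rank_term x0 q i) (N10 x0) sequentially"
      using e(3) \<open>e > 0\<close> by (auto simp: uniform_limit_iff elim!: eventually_mono)
    have "(\<lambda>q. \<Sum>i<n. rank_term x0 q i) holomorphic_on cball q0 e" for n
    proof -
      have "(x0, q) \<in> rank_dom" if "q \<in> cball q0 e" for q using that e by auto
      then show ?thesis unfolding rank_term_def
        by (intro holomorphic_intros) (auto dest: rank_domD simp del: power_Suc)
    qed
    then show "\<forall>\<^sub>F n in sequentially. continuous_on (cball q0 e) (\<lambda>q. \<Sum>i<n. rank_term x0 q i) \<and>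
        (\<lambda>q. \<Sum>i<n. rank_term x0 q i) holomorphic_on ball q0 e"
      using ball_subset_cball by (intro always_eventually allI conjI)
        (blast intro: holomorphic_on_imp_continuous_on holomorphic_on_subset)+
  qed auto
  then show "N10 x0 field_differentiable at q0"
    using e by (simp add: holomorphic_on_open field_differentiable_def)
qed

subsection \<open>Functional equations\<close>

text \<open>The point x = 1 must be excluded because it would be sent to the pole q.\<close>

lemma rank_dom_shift:
  assumes "(x, q) \<in> rank_dom" "x \<noteq> 1" "q \<noteq> 0"
  shows "(x * q, q) \<in> rank_dom"
proof -
  note D = rank_domD[OF assms(1)]
  have "x * q * q ^ n \<noteq> 1 \<and> q ^ n / (x * q) \<noteq> 1" if n: "n \<ge> 1" for n
  proof -
    obtain m where m: "n = Suc m" using n by (cases n) auto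
    have "q ^ m / x \<noteq> 1" using D(4)[of "m - 1"] assms(2) D(2) by (cases m) auto
    then show ?thesis using D(3)[of n] assms(3) by (simp add: m mult.assoc)
  qed
  then show ?thesis using D assms(3) by (auto simp: rank_dom_def)
qed

text \<open>Replacing x by xq moves the factors 1 - x q^(k+1) up by one index and the factors 1 -
  q^(k+1)/x down by one, so the products cancel except at their ends.\<close>

lemma rank_term_shift:
  assumes "(x, q) \<in> rank_dom" "x \<noteq> 1" "q \<noteq> 0"
  shows "rank_term (x * q) q n =
    rank_term x q n * ((1 - x * q) * (1 - q ^ n / x) / ((1 - x * q ^ Suc n) * (1 - 1 / x)))"
proof (induction n)
  case 0
  have "1 - x * q \<noteq> 0" "1 - 1 / x \<noteq> 0"
    using rank_domD(3)[OF assms(1), of 0] rank_domD(2)[OF assms(1)] assms(2) by auto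
  then show ?case by (simp add: rank_term_def)
next
  case (Suc n)
  note D = rank_domD[OF assms(1)] and D' = rank_domD[OF rank_dom_shift[OF assms]]
  define Q where "Q = q ^ n"
  have nz: "1 - x * q * Q \<noteq> 0" "1 - x * q * (q * Q) \<noteq> 0" "1 - q * Q / x \<noteq> 0" "1 - Q / x \<noteq> 0" "1 - 1 / x \<noteq> 0"
    using D(3)[of n] D(3)[of "Suc n"] D(4)[of n] D'(4)[of n] assms(2,3) D(2)
    by (auto simp: Q_def mult.assoc)
  have "q ^ Suc n / (x * q) = Q / x" "x * q * q ^ Suc n = x * q * (q * Q)"
    using assms(3) by (auto simp: Q_def)
  then have "rank_term (x * q) q (Suc n) = rank_term x q n * ((1 - x * q) * (1 - Q / x) / ((1 - x * q * Q) * (1 - 1 / x)))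
      * ((1 + Q) * (q * Q) / ((1 - x * q * (q * Q)) * (1 - Q / x)))"
    by (subst rank_term_Suc, subst Suc) (simp add: Q_def mult.assoc)
  also have "\<dots> = rank_term x q n * ((1 + Q) * (q * Q) / ((1 - x * q * Q) * (1 - q * Q / x)))
      * ((1 - x * q) * (1 - q * Q / x) / ((1 - x * q * (q * Q)) * (1 - 1 / x)))"
  proof -
    have "r * (A * B / (C * D)) * (P / (F * B)) = r * (P / (C * G)) * (A * G / (F * D))"
      if "B \<noteq> 0" "G \<noteq> 0" for r A B C D F G P :: complex
      using that by (simp add: mult_ac)
    from this[OF nz(4,3)] show ?thesis .
  qed
  also have "\<dots> = rank_term x q (Suc n) * ((1 - x * q) * (1 - q ^ Suc n / x) / ((1 - x * q ^ Suc (Suc n)) * (1 - 1 / x)))"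
    by (simp add: rank_term_Suc Q_def mult.assoc)
  finally show ?case .
qed

text \<open>With \<open>Q = q\<^sup>n\<close> and \<open>t\<close> the \<open>n\<close>-th term of \<open>N\<close>, this is the certificate found by Gosper's algorithm
  for the functional equation of \<open>N\<close>.\<close>

lemma rank_telescope_identity:
  fixes x q Q t :: complex
  assumes "x \<noteq> 0" "x \<noteq> 1" "x * q \<noteq> 1" "x * (q * Q) \<noteq> 1" "q * Q / x \<noteq> 1"
  defines "\<alpha> \<equiv> x * (1 - q * x\<^sup>2) / (1 - x)"
  shows "(1 + x * q) / (1 - x * q) * (t * ((1 - x * q) * (1 - Q / x) / ((1 - x * (q * Q)) * (1 - 1 / x))))
       + q * x\<^sup>2 * (1 + x) / (1 - x) * t
     = t * ((1 + Q) * (q * Q) / ((1 - x * (q * Q)) * (1 - q * Q / x))) * (1 - q * Q / x) * \<alpha>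
       - t * (1 - Q / x) * \<alpha>"
proof -
  define d where "d = 1 - x * (q * Q)"
  have d: "d \<noteq> 0" "1 - x \<noteq> 0" "1 - x * q \<noteq> 0" "1 - q * Q / x \<noteq> 0" using assms by (auto simp: d_def)
  have e: "(1 - Q / x) / (1 - 1 / x) = (Q - x) / (1 - x)"
    using assms(1) d(2) by (simp add: divide_simps) (simp add: algebra_simps)
  have "(1 + x * q) / (1 - x * q) * (t * ((1 - x * q) * (1 - Q / x) / (d * (1 - 1 / x))))
      = (1 + x * q) * t / d * ((1 - Q / x) / (1 - 1 / x))"
    using d by simp
  also have "\<dots> = (1 + x * q) * t * (Q - x) / (d * (1 - x))" by (simp add: e)
  finally have 1: "(1 + x * q) / (1 - x * q) * (t * ((1 - x * q) * (1 - Q / x) / (d * (1 - 1 / x))))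
      = (1 + x * q) * t * (Q - x) / (d * (1 - x))" .
  have 2: "t * ((1 + Q) * (q * Q) / (d * (1 - q * Q / x))) * (1 - q * Q / x) * \<alpha> - t * (1 - Q / x) * \<alpha>
      = t * (1 - q * x\<^sup>2) * ((1 + Q) * (q * Q) * x - (x - Q) * d) / (d * (1 - x))"
    unfolding \<alpha>_def using d assms(1) by (simp add: divide_simps) (simp add: algebra_simps)
  have 3: "(1 + x * q) * (Q - x) + q * x\<^sup>2 * (1 + x) * d = (1 - q * x\<^sup>2) * ((1 + Q) * (q * Q) * x - (x - Q) * d)"
    unfolding d_def by (simp add: algebra_simps power2_eq_square)
  have "(1 + x * q) * t * (Q - x) / (d * (1 - x)) + q * x\<^sup>2 * (1 + x) / (1 - x) * t
      = t * ((1 + x * q) * (Q - x) + q * x\<^sup>2 * (1 + x) * d) / (d * (1 - x))"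
    using d by (simp add: divide_simps) (simp add: algebra_simps)
  then show ?thesis using 1 2 3 by (simp add: d_def mult.assoc)
qed

text \<open>In terms of M this reads M(xq) + q x^2 M(x) = 1 - q x^2. The right-hand side is the
  lower boundary term of the telescoping sum; the upper one vanishes because the terms of N tend to
  0.\<close>

lemma N10_functional_equation:
  assumes "(x, q) \<in> rank_dom" "x \<noteq> 1" "q \<noteq> 0"
  shows "(1 + x * q) / (1 - x * q) * N10 (x * q) q + q * x\<^sup>2 * (1 + x) / (1 - x) * N10 x q = 1 - q * x\<^sup>2"
proof -
  note D = rank_domD[OF assms(1)] and D' = rank_dom_shift[OF assms]
  define \<alpha> where "\<alpha> = x * (1 - q * x\<^sup>2) / (1 - x)"
  define s where "s = (\<lambda>n. rank_term x q n * (1 - q ^ n / x) * \<alpha>)"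
  have "(1 + x * q) / (1 - x * q) * rank_term (x * q) q n + q * x\<^sup>2 * (1 + x) / (1 - x) * rank_term x q n
      = s (Suc n) - s n" for n
    using rank_telescope_identity[of x q "q ^ n" "rank_term x q n"] D(2) assms(2) D(3)[of 0] D(3,4)[of n]
    unfolding s_def \<alpha>_def rank_term_shift[OF assms] rank_term_Suc by simp
  moreover have "s \<longlonglongrightarrow> 0 * (1 - 0 / x) * \<alpha>"
    unfolding s_def using D(1,2)
    by (intro tendsto_intros summable_LIMSEQ_zero summable_rank_term assms LIMSEQ_power_zero) auto
  then have "(\<lambda>n. s (Suc n) - s n) sums (0 - s 0)"
    by (intro telescope_sums) simp
  moreover have "s 0 = - (1 - q * x\<^sup>2)"
    using D(2) assms(2) by (simp add: s_def \<alpha>_def rank_term_def divide_simps) (simp add: algebra_simps)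
  moreover have "(\<lambda>n. (1 + x * q) / (1 - x * q) * rank_term (x * q) q n + q * x\<^sup>2 * (1 + x) / (1 - x) * rank_term x q n)
      sums ((1 + x * q) / (1 - x * q) * N10 (x * q) q + q * x\<^sup>2 * (1 + x) / (1 - x) * N10 x q)"
    unfolding N10_eq_suminf[OF assms(1)] N10_eq_suminf[OF D']
    by (intro sums_add sums_mult summable_sums summable_rank_term assms D')
  ultimately show ?thesis by (simp add: sums_iff)
qed

lemma rank_dom_inverse: "(x, q) \<in> rank_dom \<Longrightarrow> (1 / x, q) \<in> rank_dom"
  unfolding rank_dom_def by (auto simp: mult.commute)

lemma N10_inverse:
  assumes "(x, q) \<in> rank_dom"
  shows "N10 (1 / x) q = N10 x q"
proof -
  have "rank_term (1 / x) q = rank_term x q"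
    by (rule ext) (simp add: rank_term_def mult.commute)
  then show ?thesis
    by (simp add: N10_eq_suminf[OF assms] N10_eq_suminf[OF rank_dom_inverse[OF assms]])
qed

section \<open>The value of N at x = 1\<close>

text \<open>The limit \<open>b \<rightarrow> \<infinity>\<close> of the terms of the q-Gauss sum with \<open>a = -1\<close>; \<open>c = q\<close> gives \<open>N\<close> at \<open>x = 1\<close>.\<close>

definition gauss_term :: "complex \<Rightarrow> complex \<Rightarrow> nat \<Rightarrow> complex" where
  "gauss_term q c n = (\<Prod>k<n. (1 + q ^ k) * (c * q ^ k) / ((1 - q ^ Suc k) * (1 - c * q ^ k)))"

lemma rank_term_one: "rank_term 1 q n = gauss_term q q n"
  unfolding rank_term_def gauss_term_def by simp

lemma norm_gauss_term_Suc_le: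
  assumes "norm q < 1" "norm c \<le> norm q"
  shows "norm (gauss_term q c (Suc n)) \<le> norm (gauss_term q c n) * (2 / (1 - norm q)\<^sup>2 * norm c * norm q ^ n)"
proof -
  have g: "norm (1 - z) \<ge> 1 - norm q" if "norm z \<le> norm q" for z :: complex
    using norm_triangle_ineq2[of 1 z] that by simp
  have q1: "norm (q ^ k) \<le> 1" for k using assms by (simp add: norm_power power_le_one)
  have "norm (1 - q ^ Suc n) * norm (1 - c * q ^ n) \<ge> (1 - norm q) * (1 - norm q)"
    using assms q1[of n] mult_mono[OF assms(2) q1[of n]]
    by (intro mult_mono g) (auto simp: norm_mult mult_left_le)
  moreover have "norm (1 + q ^ n) * (norm c * norm q ^ n) \<le> 2 * (norm c * norm q ^ n)"
    using norm_triangle_ineq[of 1 "q ^ n"] q1[of n] by (intro mult_right_mono) auto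
  ultimately have "norm (1 + q ^ n) * (norm c * norm q ^ n) / (norm (1 - q ^ Suc n) * norm (1 - c * q ^ n))
      \<le> 2 * (norm c * norm q ^ n) / ((1 - norm q) * (1 - norm q))"
    using assms by (intro frac_le) auto
  then have "norm (gauss_term q c n) * (norm (1 + q ^ n) * (norm c * norm q ^ n) / (norm (1 - q ^ Suc n) * norm (1 - c * q ^ n)))
      \<le> norm (gauss_term q c n) * (2 * (norm c * norm q ^ n) / ((1 - norm q) * (1 - norm q)))"
    by (rule mult_left_mono) simp
  then show ?thesis
    by (simp add: gauss_term_def norm_mult norm_divide norm_power power2_eq_square mult.assoc)
qed

lemma summable_gauss_term:
  assumes "norm q < 1" "norm c \<le> norm q"
  shows "summable (gauss_term q c)"
proof -
  let ?A = "2 / (1 - norm q)\<^sup>2 * norm c"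
  have "(\<lambda>n. ?A * norm q ^ n) \<longlonglongrightarrow> ?A * 0"
    using assms by (intro tendsto_intros LIMSEQ_power_zero) auto
  then have "\<forall>\<^sub>F n in sequentially. ?A * norm q ^ n < 1 / 2"
    by (rule order_tendstoD) simp
  then obtain N where N: "\<And>n. n \<ge> N \<Longrightarrow> ?A * norm q ^ n < 1 / 2"
    by (auto simp: eventually_sequentially)
  show ?thesis
  proof (rule summable_ratio_test[of "1 / 2"])
    fix n assume "n \<ge> N"
    have "norm (gauss_term q c (Suc n)) \<le> norm (gauss_term q c n) * (?A * norm q ^ n)"
      using norm_gauss_term_Suc_le[OF assms] by (simp add: mult.assoc)
    also have "\<dots> \<le> norm (gauss_term q c n) * (1 / 2)"
      using N[OF \<open>n \<ge> N\<close>] by (intro mult_left_mono) auto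
    finally show "norm (gauss_term q c (Suc n)) \<le> 1 / 2 * norm (gauss_term q c n)" by simp
  qed simp
qed

text \<open>The ratio estimate bounds the n-th term by A^n with A proportional to |c|. This is the
  limit of the sum as c tends to 0, in quantitative form.\<close>

lemma gauss_sum_near_zero:
  assumes "norm q < 1" "norm c \<le> norm q" "2 / (1 - norm q)\<^sup>2 * norm c \<le> 1 / 2"
  shows "norm ((\<Sum>n. gauss_term q c n) - 1) \<le> 2 * (2 / (1 - norm q)\<^sup>2 * norm c)"
proof -
  define A where "A = 2 / (1 - norm q)\<^sup>2 * norm c"
  have A: "0 \<le> A" "A \<le> 1 / 2" using assms by (auto simp: A_def)
  have le: "norm (gauss_term q c n) \<le> A ^ n" for n
  proof (induction n)
    case (Suc n)
    have "norm (gauss_term q c (Suc n)) \<le> norm (gauss_term q c n) * (A * norm q ^ n)"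
      using norm_gauss_term_Suc_le[OF assms(1,2)] by (simp add: A_def mult.assoc)
    also have "\<dots> \<le> A ^ n * (A * 1)"
      using Suc A assms by (intro mult_mono) (auto simp: power_le_one)
    finally show ?case by (simp add: mult.commute)
  qed (simp add: gauss_term_def)
  have "(\<Sum>n. gauss_term q c n) - 1 = (\<Sum>n. gauss_term q c (Suc n))"
    using suminf_split_head[OF summable_gauss_term[OF assms(1,2)]] by (simp add: gauss_term_def[of q c 0])
  also have "norm \<dots> \<le> (\<Sum>n. A ^ Suc n)"
    using A le by (intro norm_suminf_le) (auto simp del: power_Suc intro!: summable_Suc_iff[THEN iffD2] summable_geometric)
  also have "\<dots> = A / (1 - A)"
    using A suminf_mult[of "\<lambda>n. A ^ n" A] suminf_geometric[of A] by (simp add: summable_geometric)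
  also have "\<dots> \<le> A / (1 / 2)" using A by (intro divide_left_mono) auto
  finally show ?thesis by (simp add: A_def)
qed

lemma gauss_term_shift:
  assumes "norm q < 1" "norm c < 1"
  shows "gauss_term q (c * q) n = gauss_term q c n * (q ^ n * (1 - c) / (1 - c * q ^ n))"
proof -
  note nz = mult_power_neq_one[OF assms]
  show ?thesis
  proof (induction n)
    case 0
    then show ?case using nz[of 0] by (simp add: gauss_term_def)
  next
    case (Suc n)
    have "gauss_term q (c * q) (Suc n) = gauss_term q (c * q) n * ((1 + q ^ n) * (c * q * q ^ n) / ((1 - q ^ Suc n) * (1 - c * q * q ^ n)))"
      by (simp add: gauss_term_def)
    also have "\<dots> = gauss_term q c n * ((1 + q ^ n) * (c * q ^ n) / ((1 - q ^ Suc n) * (1 - c * q ^ n)))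
        * (q ^ Suc n * (1 - c) / (1 - c * q ^ Suc n))"
      unfolding Suc using nz[of n] nz[of "Suc n"] by (simp add: mult_ac)
    finally show ?case by (simp add: gauss_term_def)
  qed
qed

text \<open>The difference of the two summands telescopes through \<open>s\<close>. No boundary term
  survives: 1 - q^n vanishes at n = 0, and the terms tend to 0 at infinity.\<close>

lemma gauss_sum_functional_equation:
  assumes "norm q < 1" "norm c \<le> norm q"
  shows "(1 - c) * (\<Sum>n. gauss_term q c n) = (1 + c) * (\<Sum>n. gauss_term q (c * q) n)"
proof -
  have c: "norm c < 1" "norm (c * q) \<le> norm q" using assms by (auto simp: norm_mult intro: mult_left_le_one_le)
  note nz = mult_power_neq_one[OF assms(1) c(1)]
  define s where "s = (\<lambda>n. - (1 - c) * gauss_term q c n * (1 - q ^ n))"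
  have "(1 - c) * gauss_term q c n - (1 + c) * gauss_term q (c * q) n = s (Suc n) - s n" for n
  proof -
    define Q where "Q = q ^ n"
    define d where "d = 1 - c * Q"
    have d: "d \<noteq> 0" "1 - q * Q \<noteq> 0"
      using nz[of n] power_neq_one[OF assms(1), of "Suc n"] by (auto simp: d_def Q_def)
    have "gauss_term q c (Suc n) * (1 - q ^ Suc n) = gauss_term q c n * ((1 + Q) * (c * Q) / d)"
      using d by (simp add: gauss_term_def Q_def d_def)
    moreover have "gauss_term q (c * q) n = gauss_term q c n * (Q * (1 - c) / d)"
      using gauss_term_shift[OF assms(1) c(1)] by (simp add: Q_def d_def)
    moreover have "(1 - c) * g - (1 + c) * (g * (Q * (1 - c) / d))
        = - (1 - c) * (g * ((1 + Q) * (c * Q) / d)) + (1 - c) * g * (1 - Q)" for g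
      using d(1) by (simp add: divide_simps) (simp add: d_def algebra_simps)
    ultimately show ?thesis by (simp add: s_def Q_def mult.assoc) (simp add: algebra_simps)
  qed
  moreover have "s \<longlonglongrightarrow> - (1 - c) * 0 * (1 - 0)"
    unfolding s_def using assms
    by (intro tendsto_intros summable_LIMSEQ_zero summable_gauss_term LIMSEQ_power_zero) auto
  then have "(\<lambda>n. s (Suc n) - s n) sums (0 - s 0)"
    by (intro telescope_sums) simp
  moreover have "(\<lambda>n. (1 - c) * gauss_term q c n - (1 + c) * gauss_term q (c * q) n) sums
      ((1 - c) * (\<Sum>n. gauss_term q c n) - (1 + c) * (\<Sum>n. gauss_term q (c * q) n))"
    using assms c by (intro sums_diff sums_mult summable_sums summable_gauss_term)
  ultimately show ?thesis by (simp add: sums_iff s_def)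
qed

text \<open>By the functional equation, the sum times (c)/(-c), both products infinite, is unchanged
  when c becomes cq. Along c = q^(n+1) it tends to its value 1 at c = 0.\<close>

lemma gauss_sum:
  assumes "norm q < 1"
  shows "(\<Sum>n. gauss_term q q n) = qpoch_inf [-q] q / qpoch_inf [q] q"
proof -
  let ?E = "\<lambda>a. qpoch_inf [a] q"
  have E0: "?E 0 = 1" by (simp add: qpoch_inf_def)
  have contE: "isCont ?E 0"
    using qpoch_inf_holomorphic[OF assms, of UNIV]
    by (meson continuous_on_eq_continuous_at holomorphic_on_imp_continuous_on iso_tuple_UNIV_I open_UNIV)
  define L where "L = (\<lambda>c. \<Sum>n. gauss_term q c n)"
  have nz: "?E (q ^ Suc n) \<noteq> 0" "?E (- (q ^ Suc n)) \<noteq> 0" for n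
  proof -
    have "q ^ Suc n * q ^ t \<noteq> 1" "- (q ^ Suc n) * q ^ t \<noteq> 1" for t
      using power_neq_one[OF assms, of "Suc n + t"] power_neq_minus_one[OF assms, of "Suc n + t"]
      unfolding power_add by (auto simp: minus_equation_iff)
    then show "?E (q ^ Suc n) \<noteq> 0" "?E (- (q ^ Suc n)) \<noteq> 0"
      using qpoch_inf_nonzero[OF assms] by blast+
  qed
  have qn: "norm (q ^ Suc n) \<le> norm q" for n
    using assms by (simp add: norm_mult norm_power mult_left_le power_le_one)
  have step: "L (q ^ Suc n) * ?E (q ^ Suc n) / ?E (- (q ^ Suc n)) = L q * ?E q / ?E (- q)" for n
  proof (induction n)
    case (Suc n)
    define c where "c = q ^ Suc n"
    have "?E c = (1 - c) * ?E (c * q)" "?E (- c) = (1 + c) * ?E (- (c * q))"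
      using qpoch_inf_Suc[OF assms, of c] qpoch_inf_Suc[OF assms, of "-c"] by auto
    moreover have "1 + c \<noteq> 0"
      using power_neq_minus_one[OF assms, of "Suc n"] by (metis add_eq_0_iff c_def)
    moreover have "(1 - c) * L c = (1 + c) * L (c * q)"
      unfolding L_def using gauss_sum_functional_equation[OF assms qn[of n]] by (simp add: c_def)
    ultimately have "L (c * q) * ?E (c * q) / ?E (- (c * q)) = L c * ?E c / ?E (- c)"
      by (metis (no_types, lifting) mult.assoc mult.left_commute mult_divide_mult_cancel_left)
    then show ?case using Suc by (simp add: c_def mult_ac)
  qed simp
  have q0: "(\<lambda>n. q ^ Suc n) \<longlonglongrightarrow> 0"
    using LIMSEQ_Suc[OF LIMSEQ_power_zero[OF assms]] .
  let ?A = "2 / (1 - norm q)\<^sup>2"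
  have "(\<lambda>n. ?A * norm (q ^ Suc n)) \<longlonglongrightarrow> ?A * norm (0 :: complex)"
    by (intro tendsto_intros q0)
  then have "\<forall>\<^sub>F n in sequentially. ?A * norm (q ^ Suc n) < 1 / 2"
    by (rule order_tendstoD) simp
  then have ev: "\<forall>\<^sub>F n in sequentially. norm (L (q ^ Suc n) - 1) \<le> 2 * (?A * norm (q ^ Suc n))"
    unfolding L_def by eventually_elim (use qn in \<open>intro gauss_sum_near_zero[OF assms]; simp\<close>)
  have "(\<lambda>n. 2 * (?A * norm (q ^ Suc n))) \<longlonglongrightarrow> 2 * (?A * norm (0 :: complex))"
    by (intro tendsto_intros q0)
  then have "(\<lambda>n. L (q ^ Suc n) - 1) \<longlonglongrightarrow> 0"
    by (intro Lim_null_comparison[OF ev]) simp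
  then have L1: "(\<lambda>n. L (q ^ Suc n)) \<longlonglongrightarrow> 1"
    using Lim_null by blast
  have "(\<lambda>n. ?E (- (q ^ Suc n))) \<longlonglongrightarrow> ?E 0"
    using tendsto_minus[OF q0] by (intro isCont_tendsto_compose[OF contE]) simp
  then have "(\<lambda>n. L (q ^ Suc n) * ?E (q ^ Suc n) / ?E (- (q ^ Suc n))) \<longlonglongrightarrow> 1 * ?E 0 / ?E 0"
    by (intro tendsto_intros L1 isCont_tendsto_compose[OF contE q0]) (auto simp: E0)
  then have "L q * ?E q / ?E (- q) = 1"
    unfolding step by (simp add: E0 LIMSEQ_const_iff)
  then show ?thesis
    using nz[of 0] by (simp add: L_def divide_simps)
qed

lemma N10_one:
  assumes "norm q < 1"
  shows "N10 1 q = qpoch_inf [-q] q / qpoch_inf [q] q"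
proof -
  have "(1, q) \<in> rank_dom" using assms power_neq_one[OF assms] by (auto simp: rank_dom_def)
  then show ?thesis using gauss_sum[OF assms] by (simp add: N10_eq_suminf rank_term_one)
qed

subsection \<open>The heat operator\<close>

lemma open_slice:
  fixes U :: "(complex \<times> complex) set"
  assumes "open U"
  shows "open {x. (x, q) \<in> U}"
proof -
  have "open ((\<lambda>x. (x, q)) -` U)"
    by (intro open_vimage assms continuous_intros)
  then show ?thesis by (simp add: vimage_def)
qed

lemma open_slice2:
  fixes U :: "(complex \<times> complex) set"
  assumes "open U"
  shows "open {q. (x, q) \<in> U}"
proof -
  have "open ((\<lambda>q. (x, q)) -` U)"
    by (intro open_vimage assms continuous_intros)
  then show ?thesis by (simp add: vimage_def)
qed

lemma sep_holomorphic_slice: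
  assumes "f sep_holomorphic_on U" "open U"
  shows "(\<lambda>x. f x q) holomorphic_on {x. (x, q) \<in> U}"
  unfolding holomorphic_on_def
proof
  fix x assume "x \<in> {x. (x, q) \<in> U}"
  then show "(\<lambda>x. f x q) field_differentiable at x within {x. (x, q) \<in> U}"
    using assms(1) by (auto simp: sep_holomorphic_on_def intro: field_differentiable_at_within)
qed

lemma delta_x_holomorphic:
  assumes "(\<lambda>x. f x q) holomorphic_on S" "open S"
  shows "(\<lambda>x. delta_x f x q) holomorphic_on S"
  unfolding delta_x_def by (intro holomorphic_intros holomorphic_deriv assms)

lemma delta_q_holomorphic:
  assumes "f sep_holomorphic_on U" "open U"
  shows "(\<lambda>x. delta_q f x q) holomorphic_on {x. (x, q) \<in> U}"
proof -
  have "(\<lambda>x. deriv (f x) q) holomorphic_on {x. (x, q) \<in> U}"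
    unfolding holomorphic_on_def
  proof
    fix x assume "x \<in> {x. (x, q) \<in> U}"
    then show "(\<lambda>x. deriv (f x) q) field_differentiable at x within {x. (x, q) \<in> U}"
      using sep_holomorphic_deriv_field_differentiable[OF assms, of x q]
      by (simp add: field_differentiable_at_within)
  qed
  then show ?thesis unfolding delta_q_def by (intro holomorphic_intros)
qed

lemma delta_x_has_field_derivative:
  assumes "(\<lambda>x. f x q) holomorphic_on S" "open S" "x \<in> S" "x \<noteq> 0"
  shows "((\<lambda>x. f x q) has_field_derivative delta_x f x q / x) (at x)"
  using holomorphic_derivI[OF assms(1-3)] assms(4) by (simp add: delta_x_def)

lemma delta_xI:
  assumes "((\<lambda>x. f x q) has_field_derivative D) (at x)"
  shows "delta_x f x q = x * D"
  using DERIV_imp_deriv[OF assms] by (simp add: delta_x_def)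

text \<open>On \<open>(1 + x) N*(1,0,x;q)\<close> this operator reproduces the right-hand side of the first identity.\<close>

definition heat :: "(complex \<Rightarrow> complex \<Rightarrow> complex) \<Rightarrow> complex \<Rightarrow> complex \<Rightarrow> complex" where
  "heat F x q = 2 * delta_q F x q + 1 / 2 * delta_x (delta_x F) x q"

text \<open>The inhomogeneous term 1 of the functional equation is killed by the derivatives, and the
  extra \<open>\<delta>\<^sub>x\<close> terms produced by the chain rule for \<open>\<delta>\<^sub>q\<close> cancel.\<close>

lemma heat_shift:
  assumes F: "F sep_holomorphic_on U" and U: "open U"
    and dom: "\<And>x q. (x, q) \<in> U \<Longrightarrow> x \<noteq> 0 \<and> q \<noteq> 0 \<and> (x * q, q) \<in> U"
    and eq: "\<And>x q. (x, q) \<in> U \<Longrightarrow> F (x * q) q = - q * x\<^sup>2 * (F x q + 1) + 1"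
    and xq: "(x, q) \<in> U"
  shows "heat F (x * q) q = - q * x\<^sup>2 * heat F x q"
proof -
  let ?S = "{x. (x, q) \<in> U}"
  have S: "open ?S" by (rule open_slice[OF U])
  have Sx: "x \<noteq> 0" "x * q \<in> ?S" if "x \<in> ?S" for x using dom[of x q] that by auto
  have q: "q \<noteq> 0" using dom[OF xq] by simp
  note h0 = sep_holomorphic_slice[OF F U, of q]
  note h1 = delta_x_holomorphic[where f = F and q = q, OF h0 S]
  note d0 = delta_x_has_field_derivative[where f = F and q = q, OF h0 S]
  note d1 = delta_x_has_field_derivative[where f = "delta_x F" and q = q, OF h1 S]
  have dx: "delta_x F (x * q) q = - q * x\<^sup>2 * (2 * (F x q + 1) + delta_x F x q)" if x: "x \<in> ?S" for x
  proof -
    have nz: "x \<noteq> 0" "x * q \<in> ?S" "x * q \<noteq> 0" using Sx[OF x] q by auto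
    have "((\<lambda>x. F (x * q) q) has_field_derivative delta_x F (x * q) q / (x * q) * q) (at x)"
      by (rule DERIV_chain2[where f = "\<lambda>x. F x q" and g = "\<lambda>x. x * q", OF d0[OF nz(2,3)]]) (auto intro!: derivative_eq_intros)
    moreover have "((\<lambda>x. - q * x\<^sup>2 * (F x q + 1) + 1) has_field_derivative
        (- q * (2 * x) * (F x q + 1) - q * x\<^sup>2 * (delta_x F x q / x))) (at x)"
      by (rule derivative_eq_intros d0[OF x nz(1)] refl | simp)+
    then have "((\<lambda>x. F (x * q) q) has_field_derivative
        (- q * (2 * x) * (F x q + 1) - q * x\<^sup>2 * (delta_x F x q / x))) (at x)"
      by (rule has_field_derivative_transform_within_open[OF _ S x]) (simp add: eq)
    ultimately have *: "delta_x F (x * q) q / (x * q) * q = - q * (2 * x) * (F x q + 1) - q * x\<^sup>2 * (delta_x F x q / x)"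
      by (rule DERIV_unique)
    have "delta_x F (x * q) q = x * (delta_x F (x * q) q / (x * q) * q)" using nz q by simp
    also have "\<dots> = - q * x\<^sup>2 * (2 * (F x q + 1) + delta_x F x q)"
      unfolding * using nz(1) by (simp add: algebra_simps power2_eq_square)
    finally show ?thesis .
  qed
  have dxx: "delta_x (delta_x F) (x * q) q
      = - q * x\<^sup>2 * (4 * (F x q + 1) + 4 * delta_x F x q + delta_x (delta_x F) x q)"
  proof -
    have x: "x \<in> ?S" using xq by simp
    have nz: "x \<noteq> 0" "x * q \<in> ?S" "x * q \<noteq> 0" using Sx[OF x] q by auto
    have "((\<lambda>x. delta_x F (x * q) q) has_field_derivative delta_x (delta_x F) (x * q) q / (x * q) * q) (at x)"
      by (rule DERIV_chain2[where f = "\<lambda>x. delta_x F x q" and g = "\<lambda>x. x * q", OF d1[OF nz(2,3)]]) (auto intro!: derivative_eq_intros)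
    moreover have "((\<lambda>x. - q * x\<^sup>2 * (2 * (F x q + 1) + delta_x F x q)) has_field_derivative
        (- q * (2 * x) * (2 * (F x q + 1) + delta_x F x q)
         - q * x\<^sup>2 * (2 * (delta_x F x q / x) + delta_x (delta_x F) x q / x))) (at x)"
      by (rule derivative_eq_intros d0[OF x nz(1)] d1[OF x nz(1)] refl | simp)+
    then have "((\<lambda>x. delta_x F (x * q) q) has_field_derivative
        (- q * (2 * x) * (2 * (F x q + 1) + delta_x F x q)
         - q * x\<^sup>2 * (2 * (delta_x F x q / x) + delta_x (delta_x F) x q / x))) (at x)"
      by (rule has_field_derivative_transform_within_open[OF _ S x]) (simp add: dx)
    ultimately have *: "delta_x (delta_x F) (x * q) q / (x * q) * q =
        - q * (2 * x) * (2 * (F x q + 1) + delta_x F x q)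
         - q * x\<^sup>2 * (2 * (delta_x F x q / x) + delta_x (delta_x F) x q / x)"
      by (rule DERIV_unique)
    have "delta_x (delta_x F) (x * q) q = x * (delta_x (delta_x F) (x * q) q / (x * q) * q)" using nz q by simp
    also have "\<dots> = - q * x\<^sup>2 * (4 * (F x q + 1) + 4 * delta_x F x q + delta_x (delta_x F) x q)"
      unfolding * using nz(1) by (simp add: algebra_simps power2_eq_square)
    finally show ?thesis .
  qed
  have dq: "delta_x F (x * q) q + delta_q F (x * q) q = - q * x\<^sup>2 * (F x q + 1 + delta_q F x q)"
  proof -
    have dF: "(F x has_field_derivative deriv (F x) q) (at q)"
      using F xq by (auto simp: sep_holomorphic_on_def DERIV_deriv_iff_field_differentiable)
    have "((\<lambda>t. F (x * t) t) has_field_derivative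
        deriv (\<lambda>y. F y q) (x * q) * x + deriv (F (x * q)) q * 1) (at q)"
      by (rule sep_holomorphic_chain[OF F U]) (use dom[OF xq] in \<open>auto intro!: derivative_eq_intros\<close>)
    moreover have "((\<lambda>t. - t * x\<^sup>2 * (F x t + 1) + 1) has_field_derivative
        (- x\<^sup>2 * (F x q + 1) - q * x\<^sup>2 * deriv (F x) q)) (at q)"
      by (rule derivative_eq_intros dF refl | simp)+
    then have "((\<lambda>t. F (x * t) t) has_field_derivative
        (- x\<^sup>2 * (F x q + 1) - q * x\<^sup>2 * deriv (F x) q)) (at q)"
      by (rule has_field_derivative_transform_within_open[OF _ open_slice2[OF U, of x]])
         (use xq in \<open>simp_all add: eq\<close>)
    ultimately have "deriv (\<lambda>y. F y q) (x * q) * x + deriv (F (x * q)) q * 1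
        = - x\<^sup>2 * (F x q + 1) - q * x\<^sup>2 * deriv (F x) q"
      by (rule DERIV_unique)
    then have "q * (deriv (\<lambda>y. F y q) (x * q) * x + deriv (F (x * q)) q)
        = q * (- x\<^sup>2 * (F x q + 1) - q * x\<^sup>2 * deriv (F x) q)"
      by simp
    then show ?thesis by (simp add: delta_x_def delta_q_def algebra_simps)
  qed
  have dq': "delta_q F (x * q) q = - q * x\<^sup>2 * (F x q + 1 + delta_q F x q)
      + q * x\<^sup>2 * (2 * (F x q + 1) + delta_x F x q)"
  proof -
    have "delta_q F (x * q) q = - q * x\<^sup>2 * (F x q + 1 + delta_q F x q) - delta_x F (x * q) q"
      unfolding eq_diff_eq using dq by (simp only: add.commute)
    moreover have "x \<in> ?S" using xq by simp
    ultimately show ?thesis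
      by (simp only: dx mult_minus_left diff_minus_eq_add)
  qed
  show ?thesis
  proof -
    \<comment> \<open>With s = q x^2, f = F and a, b, c the derivatives \<open>delta_q\<close>,
      \<open>delta_x\<close> and \<open>delta_x\<close> twice of F: the coefficient of f + 1 is -2s
      + 4s - 2s, that of b is 2s - 2s.\<close>
    have "2 * (- s * (f + 1 + a) + s * (2 * (f + 1) + b)) + 1 / 2 * (- s * (4 * (f + 1) + 4 * b + c))
        = - s * (2 * a + 1 / 2 * c)" for s f a b c :: complex
      by (simp add: algebra_simps)
    from this[of "q * x\<^sup>2"] show ?thesis
      unfolding heat_def dxx dq' by (simp only: mult_minus_left)
  qed
qed

section \<open>Product rules, and the passage from the heat operator to the two stated right-hand
  sides\<close>

lemma delta_x_cong:
  assumes "open S" "x \<in> S" "\<And>y. y \<in> S \<Longrightarrow> f y q = g y q"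
  shows "delta_x f x q = delta_x g x q"
proof -
  have "\<forall>\<^sub>F y in nhds x. f y q = g y q"
    using assms eventually_nhds by blast
  then show ?thesis unfolding delta_x_def by (simp add: deriv_cong_ev)
qed

lemma delta_x_mult:
  assumes "(\<lambda>x. f x q) holomorphic_on S" "open S" "x \<in> S" "x \<noteq> 0" "(g has_field_derivative g') (at x)"
  shows "delta_x (\<lambda>x q. g x * f x q) x q = x * g' * f x q + g x * delta_x f x q"
proof -
  have "((\<lambda>x. g x * f x q) has_field_derivative g' * f x q + delta_x f x q / x * g x) (at x)"
    by (rule DERIV_mult[OF assms(5) delta_x_has_field_derivative[where f = f and q = q, OF assms(1-4)]])
  from delta_xI[where f = "\<lambda>x q. g x * f x q" and q = q, OF this] show ?thesis using assms(4) by (simp add: distrib_left)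
qed

text \<open>Leibniz' rule for the square of \<open>delta_x\<close>. The derivatives are given as
  quotients by x so that \<open>g1\<close> and \<open>g2\<close> are the first and second
  \<open>delta_x\<close> derivatives of \<open>g\<close>.\<close>

lemma delta_x_delta_x_mult:
  assumes f: "(\<lambda>x. f x q) holomorphic_on S" and S: "open S" "x \<in> S" "0 \<notin> S"
    and g: "\<And>x. x \<in> S \<Longrightarrow> (g has_field_derivative g1 x / x) (at x)"
    and g1: "(g1 has_field_derivative g2 / x) (at x)"
  shows "delta_x (delta_x (\<lambda>x q. g x * f x q)) x q
    = g2 * f x q + 2 * g1 x * delta_x f x q + g x * delta_x (delta_x f) x q"
proof -
  have nz: "y \<noteq> 0" if "y \<in> S" for y using that S by auto
  note h1 = delta_x_holomorphic[where f = f and q = q, OF f S(1)]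
  have "delta_x (\<lambda>x q. g x * f x q) y q = g1 y * f y q + g y * delta_x f y q" if "y \<in> S" for y
    using delta_x_mult[where f = f and q = q, OF f S(1) that nz[OF that] g[OF that]] nz[OF that] by simp
  then have "delta_x (delta_x (\<lambda>x q. g x * f x q)) x q
      = delta_x (\<lambda>y q. g1 y * f y q + g y * delta_x f y q) x q"
    by (intro delta_x_cong[OF S(1,2)])
  also have "((\<lambda>y. g1 y * f y q + g y * delta_x f y q) has_field_derivative
      (g2 / x * f x q + delta_x f x q / x * g1 x) +
      (g1 x / x * delta_x f x q + delta_x (delta_x f) x q / x * g x)) (at x)"
    by (intro DERIV_add DERIV_mult g1 g[OF S(2)] delta_x_has_field_derivative[where f = f and q = q, OF f S(1,2) nz[OF S(2)]]
        delta_x_has_field_derivative[where f = "delta_x f" and q = q, OF h1 S(1,2) nz[OF S(2)]])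
  then have "delta_x (\<lambda>y q. g1 y * f y q + g y * delta_x f y q) x q = x * ((g2 / x * f x q + delta_x f x q / x * g1 x) +
      (g1 x / x * delta_x f x q + delta_x (delta_x f) x q / x * g x))"
    by (rule delta_xI)
  also have "\<dots> = g2 * f x q + 2 * g1 x * delta_x f x q + g x * delta_x (delta_x f) x q"
  proof -
    have "x * ((a / x * b + c / x * d) + (d / x * c + e / x * k)) = a * b + 2 * d * c + k * e" for a b c d e k
      using nz[OF S(2)] by (simp add: divide_simps)
    then show ?thesis .
  qed
  finally show ?thesis .
qed

lemma delta_q_mult:
  assumes "f x field_differentiable at q"
  shows "delta_q (\<lambda>x q. g x * f x q) x q = g x * delta_q f x q"
  using assms by (simp add: delta_q_def deriv_cmult)

text \<open>The right-hand side of the second identity, equal to (1 - x)^3 times \<open>heat\<close>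
  M away from x = 1 but regular at x = 1 as well.\<close>

definition rank_pde :: "complex \<Rightarrow> complex \<Rightarrow> complex" where
  "rank_pde x q = 2 * (1 - x)\<^sup>2 * (1 + x) * delta_q N10 x q + x * (1 + x) * N10 x q
     + 2 * x * (1 - x) * delta_x N10 x q + 1 / 2 * (1 + x) * (1 - x)\<^sup>2 * delta_x (delta_x N10) x q"

definition rank_M :: "complex \<Rightarrow> complex \<Rightarrow> complex" where
  "rank_M x q = (1 + x) / (1 - x) * N10 x q"

lemma N10_slice:
  "(\<lambda>x. N10 x q) holomorphic_on {x. (x, q) \<in> rank_dom}"
  by (rule sep_holomorphic_slice[OF N10_sep_holomorphic open_rank_dom])

lemma N10_slice':
  "(\<lambda>x. N10 x q) holomorphic_on {x. (x, q) \<in> rank_dom} - {1}"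
  "open ({x. (x, q) \<in> rank_dom} - {1})" "0 \<notin> {x. (x, q) \<in> rank_dom} - {1}"
  using open_slice[OF open_rank_dom] rank_domD(2) by (auto intro: holomorphic_on_subset[OF N10_slice])

lemma N10_q_differentiable:
  "(x, q) \<in> rank_dom \<Longrightarrow> N10 x field_differentiable at q"
  using N10_sep_holomorphic by (simp add: sep_holomorphic_on_def)

lemma heat_rank_M:
  assumes "(x, q) \<in> rank_dom" "x \<noteq> 1"
  shows "(1 - x) ^ 3 * heat rank_M x q = rank_pde x q"
proof -
  let ?S = "{x. (x, q) \<in> rank_dom} - {1}"
  have x: "x \<in> ?S" using assms by simp
  have eq: "rank_M = (\<lambda>x q. (1 + x) / (1 - x) * N10 x q)" by (intro ext) (simp add: rank_M_def)
  have g: "((\<lambda>x. (1 + x) / (1 - x)) has_field_derivative (2 * x / (1 - x)\<^sup>2) / x) (at x)" if "x \<in> ?S" for x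
    using that rank_domD(2)[of x q]
    by (auto intro!: derivative_eq_intros simp: power2_eq_square)
  have g1: "((\<lambda>x. 2 * x / (1 - x)\<^sup>2) has_field_derivative (2 * x * (1 + x) / (1 - x) ^ 3) / x) (at x)"
  proof -
    have "1 - x \<noteq> 0" "x \<noteq> 0" using assms rank_domD(2)[of x q] by auto
    then show ?thesis
      by (auto intro!: derivative_eq_intros simp: divide_simps) (simp add: algebra_simps eval_nat_numeral)
  qed
  have e1: "delta_x (delta_x rank_M) x q = 2 * x * (1 + x) / (1 - x) ^ 3 * N10 x q
      + 2 * (2 * x / (1 - x)\<^sup>2) * delta_x N10 x q + (1 + x) / (1 - x) * delta_x (delta_x N10) x q"
    unfolding eq by (rule delta_x_delta_x_mult[where f = N10 and q = q, OF N10_slice'(1,2) x N10_slice'(3) g g1])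
  have e2: "delta_q rank_M x q = (1 + x) / (1 - x) * delta_q N10 x q"
    unfolding eq by (rule delta_q_mult[where f = N10, OF N10_q_differentiable[OF assms(1)]])
  have "(1 - x) ^ 3 * (2 * ((1 + x) / (1 - x) * a)
      + 1 / 2 * (2 * x * (1 + x) / (1 - x) ^ 3 * n + 2 * (2 * x / (1 - x)\<^sup>2) * b + (1 + x) / (1 - x) * c))
      = 2 * (1 - x)\<^sup>2 * (1 + x) * a + x * (1 + x) * n + 2 * x * (1 - x) * b + 1 / 2 * (1 + x) * (1 - x)\<^sup>2 * c"
    for a n b c
    using assms(2) by (simp add: divide_simps) (simp add: algebra_simps eval_nat_numeral)
  then show ?thesis
    unfolding heat_def rank_pde_def e1 e2 .
qed

text \<open>On the other side, passing from C to C* also divides by (1 - x)^3, so this reduces the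
  first identity to the second.\<close>

lemma N10_star_pde:
  assumes "(x, q) \<in> rank_dom" "x \<noteq> 1"
  shows "2 * (1 + x) * delta_q N10_star x q + 1 / 2 * x * N10_star x q
     + x * delta_x N10_star x q + 1 / 2 * (1 + x) * delta_x (delta_x N10_star) x q
    = rank_pde x q / (1 - x) ^ 3"
proof -
  let ?S = "{x. (x, q) \<in> rank_dom} - {1}"
  have x: "x \<in> ?S" and nz: "1 - x \<noteq> 0" "x \<noteq> 0" using assms rank_domD(2)[of x q] by auto
  have eq: "N10_star = (\<lambda>x q. 1 / (1 - x) * N10 x q)" by (intro ext) (simp add: N10_star_def)
  have g: "((\<lambda>x. 1 / (1 - x)) has_field_derivative (x / (1 - x)\<^sup>2) / x) (at x)" if "x \<in> ?S" for x
    using that rank_domD(2)[of x q]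
    by (auto intro!: derivative_eq_intros simp: power2_eq_square)
  have g1: "((\<lambda>x. x / (1 - x)\<^sup>2) has_field_derivative (x * (1 + x) / (1 - x) ^ 3) / x) (at x)"
    using nz by (auto intro!: derivative_eq_intros simp: divide_simps) (simp add: algebra_simps eval_nat_numeral)
  have e1: "delta_x (delta_x N10_star) x q = x * (1 + x) / (1 - x) ^ 3 * N10 x q
      + 2 * (x / (1 - x)\<^sup>2) * delta_x N10 x q + 1 / (1 - x) * delta_x (delta_x N10) x q"
    unfolding eq by (rule delta_x_delta_x_mult[where f = N10 and q = q, OF N10_slice'(1,2) x N10_slice'(3) g g1])
  have e2: "delta_x N10_star x q = x / (1 - x)\<^sup>2 * N10 x q + 1 / (1 - x) * delta_x N10 x q"
    using delta_x_mult[where f = N10 and q = q, OF N10_slice'(1,2) x nz(2) g[OF x]] nz unfolding eq by simp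
  have e3: "delta_q N10_star x q = 1 / (1 - x) * delta_q N10 x q"
    unfolding eq by (rule delta_q_mult[where f = N10, OF N10_q_differentiable[OF assms(1)]])
  have e4: "N10_star x q = 1 / (1 - x) * N10 x q" by (simp add: eq)
  have "2 * (1 + x) * (1 / (1 - x) * a) + 1 / 2 * x * (1 / (1 - x) * n)
      + x * (x / (1 - x)\<^sup>2 * n + 1 / (1 - x) * b)
      + 1 / 2 * (1 + x) * (x * (1 + x) / (1 - x) ^ 3 * n + 2 * (x / (1 - x)\<^sup>2) * b + 1 / (1 - x) * c)
      = (2 * (1 - x)\<^sup>2 * (1 + x) * a + x * (1 + x) * n + 2 * x * (1 - x) * b
        + 1 / 2 * (1 + x) * (1 - x)\<^sup>2 * c) / (1 - x) ^ 3"
    for a n b c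
    using nz by (simp add: divide_simps) (simp add: algebra_simps eval_nat_numeral)
  then show ?thesis
    unfolding rank_pde_def e1 e2 e3 e4 .
qed

lemma rank_pde_shift:
  assumes "(x, q) \<in> rank_dom" "x \<noteq> 1" "q \<noteq> 0"
  shows "rank_pde (x * q) q / (1 - x * q) ^ 3 = - q * x\<^sup>2 * (rank_pde x q / (1 - x) ^ 3)"
proof -
  \<comment> \<open>The equation is differentiated in q too, so it must hold on a set open in both
    variables; removing x = 1 and q = 0 also makes the set stable under the shift.\<close>
  define U where "U = rank_dom \<inter> {p. fst p \<noteq> 1} \<inter> {p. snd p \<noteq> 0}"
  have U: "open U" unfolding U_def
    by (intro open_Int open_rank_dom open_Collect_neq continuous_intros)
  have N: "N10 sep_holomorphic_on U"
    by (rule sep_holomorphic_on_subset[OF N10_sep_holomorphic]) (auto simp: U_def)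
  have M: "rank_M sep_holomorphic_on U"
    unfolding sep_holomorphic_on_def
  proof (intro conjI allI impI)
    show "continuous_on U (\<lambda>p. rank_M (fst p) (snd p))"
      unfolding rank_M_def using N unfolding sep_holomorphic_on_def
      by (intro continuous_intros) (auto simp: U_def)
    fix x q assume "(x, q) \<in> U"
    with N show "(\<lambda>x. rank_M x q) field_differentiable at x"
      unfolding rank_M_def sep_holomorphic_on_def
      by (intro field_differentiable_mult field_differentiable_divide) (auto simp: U_def intro!: derivative_intros)
    from N \<open>(x, q) \<in> U\<close> show "rank_M x field_differentiable at q"
      unfolding rank_M_def sep_holomorphic_on_def
      by (intro field_differentiable_mult) auto
  qed
  have shift: "x \<noteq> 0 \<and> q \<noteq> 0 \<and> (x * q, q) \<in> U" if "(x, q) \<in> U" for x q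
    using that rank_dom_shift[of x q] rank_domD(2)[of x q] rank_domD(3)[of x q 0] by (auto simp: U_def)
  have "heat rank_M (x * q) q = - q * x\<^sup>2 * heat rank_M x q"
  proof (rule heat_shift[OF M U shift])
    fix x q assume "(x, q) \<in> U"
    then have "(1 + x * q) / (1 - x * q) * N10 (x * q) q + q * x\<^sup>2 * (1 + x) / (1 - x) * N10 x q = 1 - q * x\<^sup>2"
      by (intro N10_functional_equation) (auto simp: U_def)
    then have "rank_M (x * q) q + q * x\<^sup>2 * rank_M x q = 1 - q * x\<^sup>2"
      by (simp add: rank_M_def mult.assoc)
    then show "rank_M (x * q) q = - q * x\<^sup>2 * (rank_M x q + 1) + 1"
      by (simp add: algebra_simps)
  qed (use assms in \<open>auto simp: U_def\<close>)
  moreover have "x * q \<noteq> 1" using rank_domD(3)[OF assms(1), of 0] by simp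
  moreover have "rank_pde y q / (1 - y) ^ 3 = heat rank_M y q" if "(y, q) \<in> rank_dom" "y \<noteq> 1" for y
    using heat_rank_M[OF that] that by (simp add: divide_eq_eq mult.commute)
  ultimately show ?thesis
    using assms rank_dom_shift[OF assms] by metis
qed

subsection \<open>Theta quotients and the identity\<close>

definition rank_rhs :: "complex \<Rightarrow> complex \<Rightarrow> complex" where
  "rank_rhs x q = x * ((qpoch_inf [q] q)\<^sup>2 / qpoch_inf [-q] q) * (C_fun x q) ^ 3 * J_fun (-x) q"

lemma qpoch_inf_factors_nonzero:
  assumes "(x, q) \<in> rank_dom"
  shows "qpoch_inf [x * q] q \<noteq> 0" "qpoch_inf [q / x] q \<noteq> 0"
    "qpoch_inf [q] q \<noteq> 0" "qpoch_inf [-q] q \<noteq> 0"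
proof -
  note D = rank_domD[OF assms]
  have "x * q * q ^ t \<noteq> 1" "q / x * q ^ t \<noteq> 1" "q * q ^ t \<noteq> 1" "- q * q ^ t \<noteq> 1" for t
    using D(3,4)[of t] power_neq_one[OF D(1), of "Suc t"] power_neq_minus_one[OF D(1), of "Suc t"]
    by (auto simp: mult_ac minus_equation_iff)
  then show "qpoch_inf [x * q] q \<noteq> 0" "qpoch_inf [q / x] q \<noteq> 0"
    "qpoch_inf [q] q \<noteq> 0" "qpoch_inf [-q] q \<noteq> 0"
    using qpoch_inf_nonzero[OF D(1)] by blast+
qed

text \<open>With the cube of 1 - x absorbed, this is x J(-x)/J(x)^3 up to a constant. Under the
  shift x gains q, J(-x) gains 1/x and J(x) gains -1/x; together q (1/x) (-x)^3 = -q x^2.\<close>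

lemma rank_rhs_shift:
  assumes "(x, q) \<in> rank_dom" "x \<noteq> 1" "q \<noteq> 0"
  shows "rank_rhs (x * q) q / (1 - x * q) ^ 3 = - q * x\<^sup>2 * (rank_rhs x q / (1 - x) ^ 3)"
proof -
  note D = rank_domD[OF assms(1)]
  let ?E = "\<lambda>a. qpoch_inf [a] q"
  define c where "c = (?E q)\<^sup>2 / ?E (-q) * ?E q ^ 3"
  have nz: "1 - x \<noteq> 0" "x \<noteq> 0" "1 - x * q \<noteq> 0" "?E (q / x) \<noteq> 0" "?E (x * q * q) \<noteq> 0"
    using assms D(2) D(3)[of 0] qpoch_inf_factors_nonzero[OF assms(1)]
      qpoch_inf_factors_nonzero[OF rank_dom_shift[OF assms]] by auto
  have 1: "rank_rhs x q / (1 - x) ^ 3 = c * x * ?E (-x) * ?E (- q / x) / (((1 - x) * ?E (x * q)) * ?E (q / x)) ^ 3"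
    unfolding rank_rhs_def C_fun_def J_fun_def qpoch_inf_pair[OF D(1)] c_def
    by (simp add: power_mult_distrib power_divide mult_ac)
  have 2: "rank_rhs (x * q) q / (1 - x * q) ^ 3
      = c * (x * q) * ?E (- (x * q)) * ?E (- 1 / x) / (((1 - x * q) * ?E (x * q * q)) * ?E (1 / x)) ^ 3"
    unfolding rank_rhs_def C_fun_def J_fun_def qpoch_inf_pair[OF D(1)] c_def using assms(3)
    by (simp add: power_mult_distrib power_divide mult_ac)
  have E: "?E (x * q) = (1 - x * q) * ?E (x * q * q)" "?E (1 / x) = (1 - 1 / x) * ?E (q / x)"
    "?E (- 1 / x) = (1 + 1 / x) * ?E (- q / x)" "?E (- x) = (1 + x) * ?E (- (x * q))"
    using qpoch_inf_Suc[OF D(1), of "x * q"] qpoch_inf_Suc[OF D(1), of "1 / x"]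
      qpoch_inf_Suc[OF D(1), of "- 1 / x"] qpoch_inf_Suc[OF D(1), of "- x"] by auto
  have "c * (x * q) * P * ((1 + 1 / x) * Q) / ((d * R) * ((1 - 1 / x) * T)) ^ 3
      = - q * x\<^sup>2 * (c * x * ((1 + x) * P) * Q / (((1 - x) * (d * R)) * T) ^ 3)"
    if "d \<noteq> 0" "R \<noteq> 0" "T \<noteq> 0" for P Q d R T
  proof -
    have a: "1 + 1 / x = (1 + x) / x" "1 - 1 / x = - ((1 - x) / x)" using nz by (auto simp: field_simps)
    show ?thesis unfolding a using that nz
      by (simp add: power_mult_distrib power_divide divide_simps) (simp add: eval_nat_numeral)
  qed
  from this[OF nz(3,5,4)] show ?thesis unfolding 1 2 E by simp
qed

lemma rank_identity_shift_iff:
  assumes "(x, q) \<in> rank_dom" "x \<noteq> 1" "q \<noteq> 0"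
  shows "rank_pde (x * q) q = rank_rhs (x * q) q \<longleftrightarrow> rank_pde x q = rank_rhs x q"
proof -
  have "1 - x \<noteq> 0" "1 - x * q \<noteq> 0" "x \<noteq> 0" using rank_domD(2)[OF assms(1)] rank_domD(3)[OF assms(1), of 0] assms(2) by auto
  then have "rank_pde (x * q) q / (1 - x * q) ^ 3 = rank_rhs (x * q) q / (1 - x * q) ^ 3
      \<longleftrightarrow> rank_pde x q / (1 - x) ^ 3 = rank_rhs x q / (1 - x) ^ 3"
    unfolding rank_pde_shift[OF assms] rank_rhs_shift[OF assms] using assms(3) by simp
  with \<open>1 - x \<noteq> 0\<close> \<open>1 - x * q \<noteq> 0\<close> show ?thesis by simp
qed

section \<open>The identity on the annulus\<close>

lemma annulus_constant:
  fixes p :: "complex \<Rightarrow> complex" and q :: complex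
  assumes q: "q \<noteq> 0" "norm q < 1"
    and p: "p holomorphic_on {x. norm q < norm x \<and> norm x < 1 / norm q}"
    and shift: "\<And>x. 1 < norm x \<Longrightarrow> norm x < 1 / norm q \<Longrightarrow> p (x * q) = p x"
    and x: "norm q < norm x" "norm x < 1 / norm q"
  shows "p x = p 1"
proof -
  let ?A = "{x :: complex. norm q < norm x \<and> norm x < 1 / norm q}"
  \<comment> \<open>The closed annulus with radii s and 1/s has radius ratio 1/|q|, so one shift or
    its inverse brings any other point of \<open>?A\<close> into it. It is compact inside
    \<open>?A\<close>, so the maximum of |p| over it is an interior maximum over
    \<open>?A\<close>.\<close>
  define s where "s = sqrt (norm q)"
  have s: "0 < s" "s < 1" "norm q = s * s" using q by (auto simp: s_def)
  have s1: "1 < 1 / s" using s by simp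
  let ?B = "cball 0 (1 / s) - ball (0 :: complex) s"
  have BA: "y \<in> ?A" if "y \<in> ?B" for y
  proof -
    have "norm y \<ge> s" "norm y \<le> 1 / s" using that by auto
    moreover have "s * s < s" using s by simp
    moreover have "1 / s < 1 / (s * s)" using s by (intro divide_strict_left_mono) auto
    ultimately show ?thesis by (simp only: mem_Collect_eq s(3)) linarith
  qed
  have B: "1 \<in> ?B" using s by auto
  have "compact ?B" by (intro compact_diff) auto
  moreover have "continuous_on ?B (\<lambda>x. norm (p x))"
    using holomorphic_on_imp_continuous_on[OF p] BA
    by (intro continuous_on_norm) (meson continuous_on_subset subsetI)
  ultimately obtain z where z: "z \<in> ?B" "\<And>y. y \<in> ?B \<Longrightarrow> norm (p y) \<le> norm (p z)"
    using continuous_attains_sup[of ?B "\<lambda>x. norm (p x)"] B by blast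
  have max: "norm (p y) \<le> norm (p z)" if "y \<in> ?A" for y
  proof -
    consider "norm y > 1 / s" | "norm y < s" | "y \<in> ?B" by fastforce
    then show ?thesis
    proof cases
      case 1
      have "norm (y * q) > 1 / s * (s * s)"
        unfolding norm_mult s(3) using 1 s by (intro mult_strict_right_mono) auto
      moreover have "norm (y * q) < 1 / (s * s) * (s * s)"
        unfolding norm_mult s(3) using that s by (intro mult_strict_right_mono) auto
      moreover have "1 / s * (s * s) = s" "1 / (s * s) * (s * s) = 1" using s by auto
      ultimately have "norm (y * q) \<ge> s" "norm (y * q) \<le> 1 / s" "1 < norm y"
        using 1 s1 by linarith+
      then show ?thesis using shift[of y] z(2)[of "y * q"] that by auto
    next
      case 2
      have "norm (y / q) < s / (s * s)"
        unfolding norm_divide s(3) using 2 s by (intro divide_strict_right_mono) auto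
      moreover have "norm (y / q) > (s * s) / (s * s)"
        unfolding norm_divide s(3) using that s by (intro divide_strict_right_mono) auto
      moreover have "s / (s * s) = 1 / s" "(s * s) / (s * s) = 1" using s by auto
      moreover have "1 / s < 1 / norm q"
        unfolding s(3) using s by (intro divide_strict_left_mono) auto
      ultimately have "norm (y / q) \<ge> s" "norm (y / q) \<le> 1 / s" "1 < norm (y / q)" "norm (y / q) < 1 / norm q"
        using s(2) by linarith+
      then show ?thesis using shift[of "y / q"] z(2)[of "y / q"] q by auto
    next
      case 3
      then show ?thesis using z by blast
    qed
  qed
  have "open ?A"
    by (intro open_Collect_conj open_Collect_less continuous_intros)
  moreover have "connected ?A"
    using connected_annulus(1)[of "norm q" "0 :: complex" "1 / norm q"] by simp
  ultimately have "p constant_on ?A"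
    by (intro maximum_modulus_principle[OF p, of ?A z]) (use BA[OF z(1)] max in auto)
  moreover have "1 \<in> ?A" using BA[OF B] .
  ultimately show ?thesis using x unfolding constant_on_def by auto
qed

lemma annulus_subset_rank_dom:
  assumes "q \<noteq> 0" "norm q < 1" "norm q < norm x" "norm x < 1 / norm q"
  shows "(x, q) \<in> rank_dom"
proof -
  have x: "x \<noteq> 0" using assms by auto
  have "x * q ^ n \<noteq> 1 \<and> q ^ n / x \<noteq> 1" if n: "n \<ge> 1" for n
  proof -
    have le: "norm (q ^ n) \<le> norm q"
      using n assms power_decreasing[of 1 n "norm q"] by (simp add: norm_power)
    have "norm (x * q ^ n) \<le> norm x * norm q" unfolding norm_mult by (intro mult_left_mono le) auto
    also have "\<dots> < 1" using assms by (simp add: field_simps)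
    finally have "x * q ^ n \<noteq> 1" by auto
    moreover have "q ^ n \<noteq> x" using le assms by auto
    ultimately show ?thesis using x by simp
  qed
  then show ?thesis using x assms by (auto simp: rank_dom_def)
qed

text \<open>Both \<open>rank_pde\<close> and \<open>rank_rhs\<close> contain a factor \<open>1 + x\<close>: the former because
  \<open>N(x) = N(1/x)\<close> makes \<open>\<delta>\<^sub>x N\<close> vanish at \<open>-1\<close>.\<close>

lemma delta_x_N10_minus_one:
  assumes "norm q < 1" "q \<noteq> 0"
  shows "delta_x N10 (-1) q = 0"
proof -
  let ?S = "{x. (x, q) \<in> rank_dom}"
  have m1: "-1 \<in> ?S" using annulus_subset_rank_dom[of q "-1"] assms by simp
  have S: "open ?S" by (rule open_slice[OF open_rank_dom])
  define D where "D = deriv (\<lambda>x. N10 x q) (-1)"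
  have d: "((\<lambda>x. N10 x q) has_field_derivative D) (at (-1))"
    unfolding D_def using N10_slice S m1 by (rule holomorphic_derivI)
  have "((\<lambda>x. N10 (1 / x) q) has_field_derivative D * (-1)) (at (-1))"
    by (rule DERIV_chain2[where f = "\<lambda>x. N10 x q" and g = "\<lambda>x. 1 / x"])
       (use d in \<open>auto intro!: derivative_eq_intros\<close>)
  then have "((\<lambda>x. N10 x q) has_field_derivative D * (-1)) (at (-1))"
    by (rule has_field_derivative_transform_within_open[OF _ S m1]) (simp add: N10_inverse)
  from DERIV_unique[OF d this] have "D = 0" by simp
  then show ?thesis by (simp add: delta_x_def D_def)
qed

lemma rank_identity_annulus:
  assumes q: "q \<noteq> 0" "norm q < 1" and x: "norm q < norm x" "norm x < 1 / norm q"
  shows "rank_pde x q = rank_rhs x q"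
proof -
  let ?A = "{x :: complex. norm q < norm x \<and> norm x < 1 / norm q}"
  let ?S = "{x. (x, q) \<in> rank_dom}"
  let ?E = "\<lambda>a. qpoch_inf [a] q"
  have A: "open ?A" by (intro open_Collect_conj open_Collect_less continuous_intros)
  have S: "open ?S" by (rule open_slice[OF open_rank_dom])
  have AS: "?A \<subseteq> ?S" using annulus_subset_rank_dom[OF q] by auto
  have q1: "1 < 1 / norm q" using q by simp
  have one: "1 \<in> ?A" "-1 \<in> ?A" using q q1 by auto
  \<comment> \<open>The quotient of \<open>delta_x\<close> N by 1 + x, with its removable
    singularity at -1 filled in.\<close>
  define sf where "sf = (\<lambda>x. if x = -1 then deriv (\<lambda>x. delta_x N10 x q) (-1)
      else (delta_x N10 x q - delta_x N10 (-1) q) / (x - -1))"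
  have h1: "(\<lambda>x. delta_x N10 x q) holomorphic_on ?A"
    using delta_x_holomorphic[where f = N10 and q = q, OF N10_slice S] AS by (rule holomorphic_on_subset)
  have h2: "(\<lambda>x. delta_x (delta_x N10) x q) holomorphic_on ?A"
    using delta_x_holomorphic[where f = "delta_x N10" and q = q, OF h1 A] .
  have h0: "(\<lambda>x. N10 x q) holomorphic_on ?A"
    using N10_slice AS by (rule holomorphic_on_subset)
  have hq: "(\<lambda>x. delta_q N10 x q) holomorphic_on ?A"
    using delta_q_holomorphic[OF N10_sep_holomorphic open_rank_dom] AS by (rule holomorphic_on_subset)
  have hs: "sf holomorphic_on ?A"
    unfolding sf_def by (rule pole_lemma[OF h1]) (use A one in \<open>simp add: interior_open\<close>)
  define G where "G = (\<lambda>x. 2 * (1 - x)\<^sup>2 * delta_q N10 x q + x * N10 x q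
     + 2 * x * (1 - x) * sf x + 1 / 2 * (1 - x)\<^sup>2 * delta_x (delta_x N10) x q)"
  have hG: "G holomorphic_on ?A"
    unfolding G_def by (intro holomorphic_intros h0 h1 h2 hq hs)
  have sf: "(1 + x) * sf x = delta_x N10 x q" for x
    using delta_x_N10_minus_one[OF q(2,1)] by (auto simp: sf_def add_eq_0_iff add.commute)
  have G: "rank_pde x q = (1 + x) * G x" for x
    unfolding rank_pde_def G_def sf[symmetric] by (simp add: algebra_simps)
  \<comment> \<open>The factor 1 + x of J(-x) is split off. The other zeros of J(-x) are the points
    -q^n with n nonzero, all outside the annulus, so B vanishes nowhere on it.\<close>
  define B where "B = (\<lambda>x. x * ((?E q)\<^sup>2 / ?E (-q)) * (?E q / (?E (x * q) * ?E (q / x))) ^ 3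
      * (?E (- x * q) * ?E (- q / x)))"
  have B: "rank_rhs x q = (1 + x) * B x" for x
    using qpoch_inf_Suc[OF q(2), of "-x"]
    unfolding rank_rhs_def B_def C_fun_def J_fun_def qpoch_inf_pair[OF q(2)] by (simp add: mult_ac)
  have nzm: "?E (- x * q) \<noteq> 0" "?E (- q / x) \<noteq> 0" if "x \<in> ?A" for x
    using qpoch_inf_factors_nonzero(1,2)[OF annulus_subset_rank_dom[OF q, of "-x"]] that by auto
  have nz: "?E (x * q) \<noteq> 0" "?E (q / x) \<noteq> 0" "?E q \<noteq> 0" "?E (-q) \<noteq> 0" "x \<noteq> 0" if "x \<in> ?A" for x
    using qpoch_inf_factors_nonzero[OF annulus_subset_rank_dom[OF q, of "x"]] that by auto
  have B0: "B x \<noteq> 0" if "x \<in> ?A" for x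
    using nz[OF that] nzm[OF that] by (simp add: B_def)
  have hE: "(\<lambda>x. ?E (g x)) holomorphic_on ?A" if "g holomorphic_on ?A" for g
    using holomorphic_on_compose_gen[OF that qpoch_inf_holomorphic[OF q(2), of UNIV]] by (simp add: o_def)
  have hB: "B holomorphic_on ?A"
    unfolding B_def using nz by (intro holomorphic_intros hE) auto
  have "G x / B x = G 1 / B 1"
  proof (rule annulus_constant[OF q _ _ x])
    show "(\<lambda>x. G x / B x) holomorphic_on ?A"
      by (intro holomorphic_intros hG hB B0)
    fix y :: complex assume y: "1 < norm y" "norm y < 1 / norm q"
    have yq: "norm q < norm (y * q)" "norm (y * q) < 1"
      using y q by (auto simp: norm_mult field_simps)
    \<comment> \<open>Both points lie in the annulus, and |y| > 1 > |yq| keeps them away from 1 and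
      -1, where the shift equations or the division by 1 + x would fail.\<close>
    have yA: "y \<in> ?A" "y * q \<in> ?A" using y yq q q1 by auto
    have ne: "1 + y \<noteq> 0" "1 + y * q \<noteq> 0" "1 - y \<noteq> 0" "1 - y * q \<noteq> 0" "y \<noteq> 0"
      using y yq by (auto simp: add_eq_0_iff)
    have dom: "(y, q) \<in> rank_dom" "y \<noteq> 1" using yA AS ne by auto
    have "rank_pde (y * q) q / rank_rhs (y * q) q
        = (rank_pde (y * q) q / (1 - y * q) ^ 3) / (rank_rhs (y * q) q / (1 - y * q) ^ 3)"
      using ne by simp
    also have "\<dots> = (rank_pde y q / (1 - y) ^ 3) / (rank_rhs y q / (1 - y) ^ 3)"
      unfolding rank_pde_shift[OF dom q(1)] rank_rhs_shift[OF dom q(1)] using q ne by simp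
    also have "\<dots> = rank_pde y q / rank_rhs y q" using ne by simp
    finally show "G (y * q) / B (y * q) = G y / B y"
      unfolding G B using ne by simp
  qed
  also have "\<dots> = 1"
  proof -
    \<comment> \<open>At x = 1 the factors 1 - x remove every derivative, and only N(1) is
      left.\<close>
    have "G 1 = ?E (-q) / ?E q" by (simp add: G_def N10_one[OF q(2)])
    moreover have "B 1 = ?E (-q) / ?E q"
      using nz[OF one(1)] by (simp add: B_def power2_eq_square power3_eq_cube)
    ultimately show ?thesis using nz[OF one(1)] by simp
  qed
  finally have "G x = B x" using B0[of x] x by simp
  then show ?thesis by (simp add: G B)
qed

section \<open>From the annulus to all admissible x and q\<close>

lemma rank_dom_unshift:
  assumes "(x, q) \<in> rank_dom" "x \<noteq> 1" "q \<noteq> 0"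
  shows "(x / q, q) \<in> rank_dom" "x / q \<noteq> 1"
proof -
  note D = rank_domD[OF assms(1)]
  have "x / q * q ^ n \<noteq> 1 \<and> q ^ n / (x / q) \<noteq> 1" if n: "n \<ge> 1" for n
  proof -
    obtain m where m: "n = Suc m" using n by (cases n) auto
    have "x * q ^ m \<noteq> 1" using D(3)[of "m - 1"] assms(2) D(2) by (cases m) auto
    moreover have "x / q * q ^ n = x * q ^ m" "q ^ n / (x / q) = q ^ Suc n / x"
      using assms(3) by (auto simp: m)
    ultimately show ?thesis using D(4)[of n] by (simp only: simp_thms)
  qed
  moreover have "x / q \<noteq> 0" using D(2) assms(3) by simp
  ultimately show "(x / q, q) \<in> rank_dom"
    using D(1) unfolding rank_dom_def mem_Collect_eq case_prod_conv by blast
  show "x / q \<noteq> 1" using D(5)[of 0] assms(3) by auto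
qed

text \<open>Multiplying or dividing by a power of q brings each x into the annulus. The path meets 1
  only if it starts there, since the other powers of q are outside the domain; hence the equivalence
  under one shift can be iterated.\<close>

lemma rank_identity_nonzero:
  assumes dom: "(x, q) \<in> rank_dom" and q: "q \<noteq> 0"
  shows "rank_pde x q = rank_rhs x q"
proof -
  have q1: "norm q < 1" "0 < norm q" using rank_domD[OF dom] q by auto
  let ?A = "\<lambda>x. norm q < norm x \<and> norm x < 1 / norm q"
  have A: "rank_pde x q = rank_rhs x q" if "?A x" for x
    using rank_identity_annulus[OF q q1(1)] that by auto
  have up: "rank_pde y q = rank_rhs y q" if "(y, q) \<in> rank_dom" "y \<noteq> 1" "?A (y * q ^ n)" for n y
    using that
  proof (induction n arbitrary: y)
    case (Suc n)
    have "rank_pde (y * q) q = rank_rhs (y * q) q"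
      using Suc.prems rank_dom_shift[OF Suc.prems(1,2) q] rank_domD(3)[OF Suc.prems(1), of 0]
      by (intro Suc.IH) (auto simp: mult.assoc)
    then show ?case using rank_identity_shift_iff[OF Suc.prems(1,2) q] by simp
  qed (use A in auto)
  have down: "rank_pde y q = rank_rhs y q" if "(y, q) \<in> rank_dom" "y \<noteq> 1" "?A (y / q ^ n)" for n y
    using that
  proof (induction n arbitrary: y)
    case (Suc n)
    note u = rank_dom_unshift[OF Suc.prems(1,2) q]
    have "rank_pde (y / q) q = rank_rhs (y / q) q"
      using Suc.prems u by (intro Suc.IH) auto
    then show ?case using rank_identity_shift_iff[OF u q] q by simp
  qed (use A in auto)
  \<comment> \<open>The least n below the outer radius: if n > 0, minimality puts the previous value
    at or above 1/|q|, so this one is at least 1. It serves r = |x| for large x and r = 1/|x| for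
    small x.\<close>
  have ex: "\<exists>n. r * norm q ^ n < 1 / norm q \<and> (n = 0 \<or> r * norm q ^ n \<ge> 1)" if "r > 0" for r :: real
  proof -
    have "(\<lambda>n. r * norm q ^ n) \<longlonglongrightarrow> r * 0"
      using q1 by (intro tendsto_intros LIMSEQ_power_zero) auto
    then have "\<forall>\<^sub>F n in sequentially. r * norm q ^ n < 1 / norm q"
      using q1 by (intro order_tendstoD(2)) auto
    then have ex: "\<exists>n. r * norm q ^ n < 1 / norm q" by (auto simp: eventually_sequentially)
    define n where "n = (LEAST n. r * norm q ^ n < 1 / norm q)"
    have n: "r * norm q ^ n < 1 / norm q" unfolding n_def using ex by (rule LeastI_ex)
    have "r * norm q ^ n \<ge> 1" if "n = Suc m" for m
    proof -
      have "\<not> r * norm q ^ m < 1 / norm q"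
        using that not_less_Least[of m "\<lambda>n. r * norm q ^ n < 1 / norm q"] n_def by simp
      then show ?thesis using q1 that by (simp add: field_simps)
    qed
    with n show ?thesis by (intro exI[of _ n]) (cases n, auto)
  qed
  have xnz: "norm x > 0" using rank_domD(2)[OF dom] by simp
  show ?thesis
  proof (cases "?A x")
    case False
    have x1: "x \<noteq> 1" using False q1 by auto
    show ?thesis
    proof (cases "norm x \<le> norm q")
      case False
      obtain n where n: "norm x * norm q ^ n < 1 / norm q" "n = 0 \<or> norm x * norm q ^ n \<ge> 1"
        using ex[OF xnz] by blast
      then have "?A (x * q ^ n)" using q1 False by (auto simp: norm_mult norm_power)
      then show ?thesis using up[OF dom x1] by blast
    next
      case True
      have "1 / norm x > 0" using xnz by simp
      from ex[OF this] obtain n where n: "1 / norm x * norm q ^ n < 1 / norm q" "n = 0 \<or> 1 / norm x * norm q ^ n \<ge> 1"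
        by blast
      have "n \<noteq> 0"
      proof
        assume "n = 0"
        then show False using n True xnz q1 by (simp add: field_simps)
      qed
      then have "norm x \<le> norm q ^ n" using n xnz by (simp add: field_simps)
      then have "norm (x / q ^ n) \<le> 1" using q1 by (simp add: norm_divide norm_power)
      moreover have "norm q < norm (x / q ^ n)"
        using n(1) q1 xnz by (simp add: norm_divide norm_power field_simps)
      moreover have "1 < 1 / norm q" using q1 by simp
      ultimately have "?A (x / q ^ n)" by linarith
      then show ?thesis using down[OF dom x1] by blast
    qed
  qed (use A in blast)
qed

text \<open>At q = 0 the shift degenerates, but N is constantly 1 in x and \<open>delta_q\<close>
  carries the factor q = 0, so both sides reduce to x(1 + x).\<close>

lemma rank_identity_zero:
  assumes "x \<noteq> 0"
  shows "rank_pde x 0 = rank_rhs x 0"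
proof -
  have dom: "(y, 0) \<in> rank_dom" if "y \<noteq> 0" for y using that by (auto simp: rank_dom_def power_0_left)
  have t: "rank_term y 0 n = (if n = 0 then 1 else 0)" for y n
    by (auto simp: rank_term_def prod_zero_iff intro: prod_zero)
  have N: "N10 y 0 = 1" if "y \<noteq> 0" for y
  proof -
    have "(\<Sum>n. rank_term y 0 n) = (\<Sum>n\<in>{0}. rank_term y 0 n)"
      by (rule suminf_finite) (auto simp: t)
    then have "(\<Sum>n. rank_term y 0 n) = 1" by (simp only: t) simp
    then show ?thesis by (simp only: N10_eq_suminf[OF dom[OF that]])
  qed
  have d1: "delta_x N10 y 0 = 0" if "y \<noteq> 0" for y
  proof -
    have "delta_x N10 y 0 = delta_x (\<lambda>_ _. 1) y 0"
      by (rule delta_x_cong[of "-{0}"]) (use that N in auto)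
    then show ?thesis by (simp add: delta_x_def)
  qed
  have "delta_x (delta_x N10) x 0 = delta_x (\<lambda>_ _. 0) x 0"
    by (rule delta_x_cong[of "-{0}"]) (use assms d1 in auto)
  then have "rank_pde x 0 = x * (1 + x)"
    using N d1 assms by (simp add: rank_pde_def delta_q_def delta_x_def)
  \<comment> \<open>Only the factor with exponent 0 differs from 1, as the power of 0 with exponent
    0 is 1.\<close>
  moreover have E: "qpoch_inf [a] 0 = 1 - a" for a
    using qpoch_inf_split[of 0 a 1] by (simp add: qpoch_inf_def)
  have "rank_rhs x 0 = x * (1 + x)"
    unfolding rank_rhs_def C_fun_def J_fun_def by (simp add: qpoch_inf_pair E)
  ultimately show ?thesis by simp
qed

theorem theorem4p2:
  fixes x q :: complex
  assumes "norm q < 1"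
    and "x \<noteq> 0"
    and "\<And>n::nat. n \<ge> 1 \<Longrightarrow> x * q ^ n \<noteq> 1 \<and> q ^ n / x \<noteq> 1"
  shows "(x \<noteq> 1 \<longrightarrow>
           x * ((qpoch_inf [q] q)\<^sup>2 / qpoch_inf [-q] q) * (C_star x q) ^ 3 * J_fun (-x) q
           = 2 * (1 + x) * delta_q N10_star x q + 1 / 2 * x * N10_star x q
             + x * delta_x N10_star x q + 1 / 2 * (1 + x) * delta_x (delta_x N10_star) x q)
       \<and> x * ((qpoch_inf [q] q)\<^sup>2 / qpoch_inf [-q] q) * (C_fun x q) ^ 3 * J_fun (-x) q
           = 2 * (1 - x)\<^sup>2 * (1 + x) * delta_q N10 x q + x * (1 + x) * N10 x q
             + 2 * x * (1 - x) * delta_x N10 x q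
             + 1 / 2 * (1 + x) * (1 - x)\<^sup>2 * delta_x (delta_x N10) x q"
proof -
  have dom: "(x, q) \<in> rank_dom" using assms by (simp add: rank_dom_def)
  have id: "rank_pde x q = rank_rhs x q"
    using rank_identity_nonzero[OF dom] rank_identity_zero[OF assms(2)] by (cases "q = 0") auto
  have "x * ((qpoch_inf [q] q)\<^sup>2 / qpoch_inf [-q] q) * (C_star x q) ^ 3 * J_fun (-x) q = rank_rhs x q / (1 - x) ^ 3"
    by (simp add: rank_rhs_def C_star_def power_divide)
  then show ?thesis
    using N10_star_pde[OF dom] id unfolding rank_rhs_def[symmetric] rank_pde_def[symmetric] by simp
qed

end
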